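(* Let $\mathfrak G$ be the Gurarij space, $G=\operatorname{Aut}(\mathfrak G)$ its group of surjective linear isometries with the strong operator topology, and $S_{\mathfrak G}$ its unit sphere. The maximal equivariant compactification of the $G$-space $S_{\mathfrak G}$ is metrizable and does not coincide with (i.e. is not equivalent to) the Gromov compactification of $S_{\mathfrak G}$.
   Context: The Gurarij space $\mathfrak G$ is the unique separable, approximately ultrahomogeneous real Banach space that is universal for finite-dimensional normed spaces (every finite-dimensional real normed space embeds linearly isometrically in $\mathfrak G$). Approximately ultrahomogeneous: every linear isometry between finite-dimensional subspaces can be approximated, up to any $\varepsilon>0$ (on any finite set of vectors), by the restriction of a surjective linear isometry of the whole space. Equivariant compactifications: a $G$-space is a Tychonoff space $X$ with a continuous left action of the topological group $G$. An equivariant compactification of $X$ is a compact Hausdorff $G$-space $K$ with a continuous $G$-equivariant map $\nu\colon X\to K$ with dense image. A compactification $\nu'\colon X\to K'$ is a factor of $\nu\colon X\to K$ if there is a continuous $\pi\colon K\to K'$ with $\pi\circ\nu=\nu'$; two compactifications are equivalent if each is a factor of the other. The maximal equivariant compactification is the one of which every equivariant compactification is a factor. Gromov compactification of a bounded metric space $(X,d)$: the compactification corresponding to the closed unital subalgebra of the algebra of bounded continuous real functions on $X$ generated by the functions $x\mapsto d(x,z)$, $z\in X$. Here $S_{\mathfrak G}$ carries the norm metric. *)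

theory Defs
  imports "HOL-Analysis.Analysis" "HOL-Algebra.Group_Action"
begin

no_notation eq_closure_of (\<open>closure'_of\<index>\<close>)

section \<open>Compactifications\<close>

text \<open>A compactification is not required to be an embedding.\<close>

definition compactification :: "'x topology \<Rightarrow> 'k topology \<Rightarrow> ('x \<Rightarrow> 'k) \<Rightarrow> bool" where
  "compactification X K \<nu> \<longleftrightarrow>
     compact_space K \<and> Hausdorff_space K \<and> continuous_map X K \<nu> \<and>
     K closure_of (\<nu> ` topspace X) = topspace K"

definition compactification_factor ::
  "'x topology \<Rightarrow> 'k topology \<Rightarrow> ('x \<Rightarrow> 'k) \<Rightarrow> 'l topology \<Rightarrow> ('x \<Rightarrow> 'l) \<Rightarrow> bool" where
  \<comment> \<open>\<open>\<nu>'\<close> is a factor of \<open>\<nu>\<close>\<close>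
  "compactification_factor X K \<nu> K' \<nu>' \<longleftrightarrow>
     (\<exists>\<pi>. continuous_map K K' \<pi> \<and> (\<forall>x\<in>topspace X. \<pi> (\<nu> x) = \<nu>' x))"

definition compactification_equiv ::
  "'x topology \<Rightarrow> 'k topology \<Rightarrow> ('x \<Rightarrow> 'k) \<Rightarrow> 'l topology \<Rightarrow> ('x \<Rightarrow> 'l) \<Rightarrow> bool" where
  "compactification_equiv X K \<nu> K' \<nu>' \<longleftrightarrow>
     compactification_factor X K \<nu> K' \<nu>' \<and> compactification_factor X K' \<nu>' K \<nu>"

section \<open>Topological groups, G-spaces and equivariant compactifications\<close>

definition topological_group :: "('g, 'm) monoid_scheme \<Rightarrow> 'g topology \<Rightarrow> bool" where
  "topological_group G T \<longleftrightarrow>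
     group G \<and> topspace T = carrier G \<and>
     continuous_map (prod_topology T T) T (\<lambda>(g, h). g \<otimes>\<^bsub>G\<^esub> h) \<and>
     continuous_map T T (\<lambda>g. inv\<^bsub>G\<^esub> g)"

definition G_space ::
  "('g, 'm) monoid_scheme \<Rightarrow> 'g topology \<Rightarrow> 'x topology \<Rightarrow> ('g \<Rightarrow> 'x \<Rightarrow> 'x) \<Rightarrow> bool" where
  "G_space G T X \<phi> \<longleftrightarrow>
     topological_group G T \<and> completely_regular_space X \<and> Hausdorff_space X \<and>
     group_action G (topspace X) \<phi> \<and>
     continuous_map (prod_topology T X) X (\<lambda>(g, x). \<phi> g x)"

definition equivariant_compactification ::
  "('g, 'm) monoid_scheme \<Rightarrow> 'g topology \<Rightarrow> 'x topology \<Rightarrow> ('g \<Rightarrow> 'x \<Rightarrow> 'x) \<Rightarrow>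
   'k topology \<Rightarrow> ('g \<Rightarrow> 'k \<Rightarrow> 'k) \<Rightarrow> ('x \<Rightarrow> 'k) \<Rightarrow> bool" where
  "equivariant_compactification G T X \<phi> K \<psi> \<nu> \<longleftrightarrow>
     compactification X K \<nu> \<and> G_space G T K \<psi> \<and>
     (\<forall>g\<in>carrier G. \<forall>x\<in>topspace X. \<nu> (\<phi> g x) = \<psi> g (\<nu> x))"

text \<open>
  A definition cannot quantify over types, so the competing compactifications are taken on the
  type \<^typ>\<open>'x set set\<close>. This loses nothing: a point \<open>k\<close> of a compactification of \<open>X\<close> is determined by
  the subsets of \<open>X\<close> whose image has \<open>k\<close> in its closure. The lemma
  \<open>maximal_equivariant_compactification_factor\<close> below shows that a maximal equivariant
  compactification in this sense has every equivariant compactification, on whatever type,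
  as a factor.
\<close>

definition maximal_equivariant_compactification ::
  "('g, 'm) monoid_scheme \<Rightarrow> 'g topology \<Rightarrow> 'x topology \<Rightarrow> ('g \<Rightarrow> 'x \<Rightarrow> 'x) \<Rightarrow>
   'k topology \<Rightarrow> ('g \<Rightarrow> 'k \<Rightarrow> 'k) \<Rightarrow> ('x \<Rightarrow> 'k) \<Rightarrow> bool" where
  "maximal_equivariant_compactification G T X \<phi> K \<psi> \<nu> \<longleftrightarrow>
     equivariant_compactification G T X \<phi> K \<psi> \<nu> \<and>
     (\<forall>(K' :: 'x set set topology) \<psi>' \<nu>'.
        equivariant_compactification G T X \<phi> K' \<psi>' \<nu>' \<longrightarrow>
        compactification_factor X K \<nu> K' \<nu>')"

section \<open>The Gromov compactification\<close>

text \<open>Real functions on the space \<open>X\<close> are represented by extensional functions.\<close>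

definition bounded_continuous_functions :: "'x topology \<Rightarrow> ('x \<Rightarrow> real) set" where
  "bounded_continuous_functions X =
     {f \<in> extensional (topspace X). continuous_map X euclideanreal f \<and> bounded (f ` topspace X)}"

definition closed_unital_subalgebra :: "'x topology \<Rightarrow> ('x \<Rightarrow> real) set \<Rightarrow> bool" where
  "closed_unital_subalgebra X A \<longleftrightarrow>
     A \<subseteq> bounded_continuous_functions X \<and>
     (\<lambda>x\<in>topspace X. 1) \<in> A \<and>
     (\<forall>f\<in>A. \<forall>g\<in>A. (\<lambda>x\<in>topspace X. f x + g x) \<in> A) \<and>
     (\<forall>f\<in>A. \<forall>g\<in>A. (\<lambda>x\<in>topspace X. f x * g x) \<in> A) \<and>
     (\<forall>c. \<forall>f\<in>A. (\<lambda>x\<in>topspace X. c * f x) \<in> A) \<and>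
     (\<forall>s f. (\<forall>n. s n \<in> A) \<and> f \<in> extensional (topspace X) \<and>
        uniform_limit (topspace X) s f sequentially \<longrightarrow> f \<in> A)"

definition generated_closed_unital_subalgebra ::
  "'x topology \<Rightarrow> ('x \<Rightarrow> real) set \<Rightarrow> ('x \<Rightarrow> real) set" where
  "generated_closed_unital_subalgebra X F = \<Inter>{A. closed_unital_subalgebra X A \<and> F \<subseteq> A}"

definition compactification_of_algebra ::
  "'x topology \<Rightarrow> ('x \<Rightarrow> real) set \<Rightarrow> 'k topology \<Rightarrow> ('x \<Rightarrow> 'k) \<Rightarrow> bool" where
  "compactification_of_algebra X A K \<nu> \<longleftrightarrow>
     compactification X K \<nu> \<and>
     {(\<lambda>x\<in>topspace X. h (\<nu> x)) |h. continuous_map K euclideanreal h} = A"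

definition gromov_compactification ::
  "'x set \<Rightarrow> ('x \<Rightarrow> 'x \<Rightarrow> real) \<Rightarrow> 'k topology \<Rightarrow> ('x \<Rightarrow> 'k) \<Rightarrow> bool" where
  "gromov_compactification M d K \<nu> \<longleftrightarrow>
     compactification_of_algebra (Metric_space.mtopology M d)
       (generated_closed_unital_subalgebra (Metric_space.mtopology M d)
          {(\<lambda>x\<in>M. d x z) |z. z \<in> M})
       K \<nu>"

section \<open>The Gurarij space\<close>

definition linear_isometry_on ::
  "'a::real_normed_vector set \<Rightarrow> ('a \<Rightarrow> 'b::real_normed_vector) \<Rightarrow> bool" where
  "linear_isometry_on E f \<longleftrightarrow>
     (\<forall>x\<in>E. \<forall>y\<in>E. f (x + y) = f x + f y) \<and> (\<forall>c. \<forall>x\<in>E. f (c *\<^sub>R x) = c *\<^sub>R f x) \<and>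
     (\<forall>x\<in>E. norm (f x) = norm x)"

definition Aut :: "('a::real_normed_vector \<Rightarrow>\<^sub>L 'a) monoid" where
  "Aut = \<lparr>carrier = {T. (\<forall>x. norm (blinfun_apply T x) = norm x) \<and> surj (blinfun_apply T)},
          mult = (o\<^sub>L), one = id_blinfun\<rparr>"

definition Aut_topology :: "('a::real_normed_vector \<Rightarrow>\<^sub>L 'a) topology" where
  "Aut_topology = subtopology strong_operator_topology (carrier Aut)"

text \<open>The subspace \<open>F\<close> need not be mentioned: it may be taken to be \<open>f ` E\<close>.\<close>

definition approximately_ultrahomogeneous :: "'a::real_normed_vector itself \<Rightarrow> bool" where
  "approximately_ultrahomogeneous _ \<longleftrightarrow>
     (\<forall>(E :: 'a set) (f :: 'a \<Rightarrow> 'a).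
        subspace E \<and> (\<exists>B. finite B \<and> E = span B) \<and> linear_isometry_on E f \<longrightarrow>
        (\<forall>\<epsilon>>0. \<forall>S. finite S \<and> S \<subseteq> E \<longrightarrow>
           (\<exists>T\<in>carrier Aut. \<forall>x\<in>S. norm (blinfun_apply T x - f x) < \<epsilon>)))"

text \<open>
  Every finite-dimensional normed space is \<open>\<real>\<^sup>n\<close> with some norm \<open>p\<close>; the vectors of \<open>\<real>\<^sup>n\<close> are
  represented by the sequences vanishing from index \<open>n\<close> on.
\<close>

definition fin_vectors :: "nat \<Rightarrow> (nat \<Rightarrow> real) set" where
  "fin_vectors n = {c. \<forall>i\<ge>n. c i = 0}"

definition norm_on_fin_vectors :: "nat \<Rightarrow> ((nat \<Rightarrow> real) \<Rightarrow> real) \<Rightarrow> bool" where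
  "norm_on_fin_vectors n p \<longleftrightarrow>
     (\<forall>c\<in>fin_vectors n. 0 \<le> p c \<and> (p c = 0 \<longleftrightarrow> c = (\<lambda>_. 0))) \<and>
     (\<forall>a. \<forall>c\<in>fin_vectors n. p (\<lambda>i. a * c i) = \<bar>a\<bar> * p c) \<and>
     (\<forall>c\<in>fin_vectors n. \<forall>d\<in>fin_vectors n. p (\<lambda>i. c i + d i) \<le> p c + p d)"

definition universal_for_finite_dimensional :: "'a::real_normed_vector itself \<Rightarrow> bool" where
  "universal_for_finite_dimensional _ \<longleftrightarrow>
     (\<forall>n p. norm_on_fin_vectors n p \<longrightarrow>
        (\<exists>J :: (nat \<Rightarrow> real) \<Rightarrow> 'a.
           (\<forall>c\<in>fin_vectors n. \<forall>d\<in>fin_vectors n. J (\<lambda>i. c i + d i) = J c + J d) \<and>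
           (\<forall>a. \<forall>c\<in>fin_vectors n. J (\<lambda>i. a * c i) = a *\<^sub>R J c) \<and>
           (\<forall>c\<in>fin_vectors n. norm (J c) = p c)))"

definition gurarij_space :: "'a::banach itself \<Rightarrow> bool" where
  "gurarij_space TYPE('a) \<longleftrightarrow>
     separable_space (euclidean :: 'a topology) \<and>
     approximately_ultrahomogeneous TYPE('a) \<and>
     universal_for_finite_dimensional TYPE('a)"

abbreviation unit_sphere :: "'a::real_normed_vector set" where
  "unit_sphere \<equiv> sphere 0 1"

definition sphere_action :: "('a::real_normed_vector \<Rightarrow>\<^sub>L 'a) \<Rightarrow> 'a \<Rightarrow> 'a" where
  "sphere_action T = restrict (blinfun_apply T) unit_sphere"

section \<open>The universe of compactifications is large enough\<close>

lemma compact_Hausdorff_completely_regular: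
  "compact_space K \<Longrightarrow> Hausdorff_space K \<Longrightarrow> completely_regular_space K"
  by (simp add: compact_Hausdorff_or_regular_imp_normal_space normal_imp_completely_regular_space)

lemma group_actionI:
  assumes "group G"
    and "\<And>g. g \<in> carrier G \<Longrightarrow> \<phi> g \<in> extensional E"
    and "\<And>g x. g \<in> carrier G \<Longrightarrow> x \<in> E \<Longrightarrow> \<phi> g x \<in> E"
    and "\<And>x. x \<in> E \<Longrightarrow> \<phi> \<one>\<^bsub>G\<^esub> x = x"
    and "\<And>g h x. g \<in> carrier G \<Longrightarrow> h \<in> carrier G \<Longrightarrow> x \<in> E \<Longrightarrow> \<phi> (g \<otimes>\<^bsub>G\<^esub> h) x = \<phi> g (\<phi> h x)"
  shows "group_action G E \<phi>"
proof -
  interpret group G by fact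
  have inv: "\<phi> (inv\<^bsub>G\<^esub> g) (\<phi> g x) = x" "\<phi> g (\<phi> (inv\<^bsub>G\<^esub> g) x) = x"
    if "g \<in> carrier G" "x \<in> E" for g x
    using assms(4)[of x] assms(5)[of "inv\<^bsub>G\<^esub> g" g x] assms(5)[of g "inv\<^bsub>G\<^esub> g" x] that by auto
  have bij: "\<phi> g \<in> Bij E" if "g \<in> carrier G" for g
    unfolding Bij_def using that assms(2,3) inv
    by (auto intro!: bij_betw_byWitness[where f' = "\<phi> (inv\<^bsub>G\<^esub> g)"])
  have "\<phi> \<in> hom G (BijGroup E)"
  proof (rule homI)
    fix g h assume gh: "g \<in> carrier G" "h \<in> carrier G"
    show "\<phi> (g \<otimes>\<^bsub>G\<^esub> h) = \<phi> g \<otimes>\<^bsub>BijGroup E\<^esub> \<phi> h"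
      using gh bij assms(2)[of "g \<otimes>\<^bsub>G\<^esub> h"] assms(5)
      by (auto simp: BijGroup_def compose_def extensional_def fun_eq_iff)
  qed (use bij in \<open>auto simp: BijGroup_def\<close>)
  then show ?thesis
    by (auto simp: group_action_def group_hom_def group_hom_axioms_def group_BijGroup assms(1))
qed

lemma G_spaceD:
  assumes "G_space G T X \<phi>"
  shows "group G" "topspace T = carrier G"
    and "\<And>g x. g \<in> carrier G \<Longrightarrow> x \<in> topspace X \<Longrightarrow> \<phi> g x \<in> topspace X"
    and "\<And>x. x \<in> topspace X \<Longrightarrow> \<phi> \<one>\<^bsub>G\<^esub> x = x"
    and "\<And>g h x. g \<in> carrier G \<Longrightarrow> h \<in> carrier G \<Longrightarrow> x \<in> topspace X \<Longrightarrow>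
           \<phi> (g \<otimes>\<^bsub>G\<^esub> h) x = \<phi> g (\<phi> h x)"
    and "continuous_map (prod_topology T X) X (\<lambda>(g, x). \<phi> g x)"
proof -
  interpret group_action G "topspace X" \<phi>
    using assms by (simp add: G_space_def)
  show "group G" "topspace T = carrier G"
    using assms by (auto simp: G_space_def topological_group_def)
  show "\<phi> g x \<in> topspace X" if "g \<in> carrier G" "x \<in> topspace X" for g x
    using surj_prop that by blast
  show "\<phi> \<one>\<^bsub>G\<^esub> x = x" if "x \<in> topspace X" for x
    using id_eq_one that by (metis restrict_apply')
  show "\<phi> (g \<otimes>\<^bsub>G\<^esub> h) x = \<phi> g (\<phi> h x)"
    if "g \<in> carrier G" "h \<in> carrier G" "x \<in> topspace X" for g h x
    using composition_rule that by blast
  show "continuous_map (prod_topology T X) X (\<lambda>(g, x). \<phi> g x)"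
    using assms by (simp add: G_space_def)
qed

lemma transfer_topology:
  assumes "inj_on e (topspace K)"
  obtains K' where "homeomorphic_maps K K' e (inv_into (topspace K) e)"
proof
  let ?i = "inv_into (topspace K) e"
  let ?K = "pullback_topology (e ` topspace K) ?i K"
  have top: "topspace ?K = e ` topspace K"
    using assms by (auto simp: topspace_pullback_topology)
  have "continuous_map K ?K e"
  proof (rule continuous_map_pullback')
    show "continuous_map K K (?i \<circ> e)"
      by (rule continuous_map_eq[of _ _ id]) (use assms in auto)
  qed auto
  moreover have "continuous_map ?K K ?i"
    using continuous_map_pullback[of K K id "e ` topspace K" ?i] by simp
  ultimately show "homeomorphic_maps K ?K e ?i"
    unfolding homeomorphic_maps_def top using assms by auto
qed

lemma transfer_equivariant_compactification:
  fixes K :: "'k topology" and e :: "'k \<Rightarrow> 'l"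
  assumes "equivariant_compactification G T X \<phi> K \<psi> \<nu>" and inj: "inj_on e (topspace K)"
  obtains K' :: "'l topology" and \<psi>' \<nu>' where
    "equivariant_compactification G T X \<phi> K' \<psi>' \<nu>'" "compactification_equiv X K \<nu> K' \<nu>'"
proof -
  let ?i = "inv_into (topspace K) e"
  obtain K' where hom: "homeomorphic_maps K K' e ?i"
    using transfer_topology[OF inj] .
  have comp: "compact_space K" "Hausdorff_space K" "continuous_map X K \<nu>"
      "K closure_of (\<nu> ` topspace X) = topspace K" and GK: "G_space G T K \<psi>"
    and eqv: "\<And>g x. g \<in> carrier G \<Longrightarrow> x \<in> topspace X \<Longrightarrow> \<nu> (\<phi> g x) = \<psi> g (\<nu> x)"
    using assms(1) by (auto simp: equivariant_compactification_def compactification_def)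
  have e: "continuous_map K K' e" and i: "continuous_map K' K ?i"
    and ie: "\<And>k. k \<in> topspace K \<Longrightarrow> ?i (e k) = k" and ei: "\<And>l. l \<in> topspace K' \<Longrightarrow> e (?i l) = l"
    using hom by (auto simp: homeomorphic_maps_def)
  have eK: "e k \<in> topspace K'" if "k \<in> topspace K" for k
    using e that by (auto simp: continuous_map_def)
  have iK: "?i k \<in> topspace K" if "k \<in> topspace K'" for k
    using i that by (auto simp: continuous_map_def)
  have \<nu>X: "\<nu> x \<in> topspace K" if "x \<in> topspace X" for x
    using comp(3) that by (auto simp: continuous_map_def)
  note act = G_spaceD[OF GK]
  have KK': "K homeomorphic_space K'"
    using hom homeomorphic_space_def by blast
  then have c': "compact_space K'" and h': "Hausdorff_space K'"
    using comp homeomorphic_compact_space homeomorphic_Hausdorff_space by blast+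
  define \<psi>' where "\<psi>' g = (\<lambda>l\<in>topspace K'. e (\<psi> g (?i l)))" for g
  define \<nu>' where "\<nu>' x = e (\<nu> x)" for x
  have "group_action G (topspace K') \<psi>'"
    by (rule group_actionI) (use act(1,3,4,5) in \<open>auto simp: \<psi>'_def eK iK ie ei\<close>)
  moreover have "continuous_map (prod_topology T K') K' (\<lambda>(g, l). \<psi>' g l)"
  proof (rule continuous_map_eq)
    have "continuous_map (prod_topology T K') (prod_topology T K) (\<lambda>p. (fst p, ?i (snd p)))"
      by (intro continuous_map_pairedI continuous_map_fst
            continuous_map_compose[OF continuous_map_snd i, unfolded o_def])
    from continuous_map_compose[OF continuous_map_compose[OF this act(6)] e]
    show "continuous_map (prod_topology T K') K' (\<lambda>p. e (\<psi> (fst p) (?i (snd p))))"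
      by (simp add: o_def)
  qed (auto simp: \<psi>'_def)
  ultimately have "G_space G T K' \<psi>'"
    using GK c' h' by (simp add: G_space_def compact_Hausdorff_completely_regular)
  moreover have "compactification X K' \<nu>'"
    unfolding compactification_def
  proof (intro conjI c' h')
    show "continuous_map X K' \<nu>'"
      using continuous_map_compose[OF comp(3) e] by (simp add: \<nu>'_def[abs_def] o_def)
    have "e ` (K closure_of (\<nu> ` topspace X)) \<subseteq> K' closure_of (e ` \<nu> ` topspace X)"
      by (rule continuous_map_image_closure_subset[OF e])
    moreover have "topspace K' \<subseteq> e ` topspace K"
      using ei iK by (metis image_eqI subsetI)
    ultimately have "topspace K' \<subseteq> K' closure_of (\<nu>' ` topspace X)"
      by (simp add: comp(4) \<nu>'_def image_image)
    then show "K' closure_of (\<nu>' ` topspace X) = topspace K'"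
      by (simp add: closure_of_subset_topspace subset_antisym)
  qed
  moreover have "\<nu>' (\<phi> g x) = \<psi>' g (\<nu>' x)" if "g \<in> carrier G" "x \<in> topspace X" for g x
    using that by (simp add: \<nu>'_def \<psi>'_def eqv ie eK \<nu>X)
  ultimately have "equivariant_compactification G T X \<phi> K' \<psi>' \<nu>'"
    by (simp add: equivariant_compactification_def)
  moreover have "compactification_equiv X K \<nu> K' \<nu>'"
    unfolding compactification_equiv_def compactification_factor_def
    using e i by (auto simp: \<nu>'_def ie \<nu>X)
  ultimately show ?thesis
    using that by blast
qed

lemma equivariant_compactification_on_universe:
  fixes X :: "'x topology"
  assumes ec: "equivariant_compactification G T X \<phi> K \<psi> \<nu>"
  obtains K' :: "'x set set topology" and \<psi>' \<nu>' where
    "equivariant_compactification G T X \<phi> K' \<psi>' \<nu>'" "compactification_equiv X K \<nu> K' \<nu>'"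
proof -
  have comp: "Hausdorff_space K" "K closure_of (\<nu> ` topspace X) = topspace K"
    using ec by (auto simp: equivariant_compactification_def compactification_def)
  define e where "e k = {A. A \<subseteq> topspace X \<and> k \<in> K closure_of (\<nu> ` A)}" for k
  have "inj_on e (topspace K)"
  proof (rule inj_onI, rule ccontr)
    fix k l assume kl: "k \<in> topspace K" "l \<in> topspace K" "e k = e l" "k \<noteq> l"
    obtain U V where UV: "openin K U" "openin K V" "k \<in> U" "l \<in> V" "disjnt U V"
      using comp(1)[unfolded Hausdorff_space_def, rule_format, of k l] kl by metis
    let ?A = "{x \<in> topspace X. \<nu> x \<in> U}"
    have "k \<in> K closure_of (\<nu> ` ?A)"
      unfolding in_closure_of
    proof (intro conjI allI impI kl(1))
      fix W assume W: "k \<in> W \<and> openin K W"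
      have "k \<in> K closure_of (\<nu> ` topspace X)"
        using comp(2) kl(1) by simp
      then have "\<exists>y. y \<in> \<nu> ` topspace X \<and> y \<in> U \<inter> W"
        unfolding in_closure_of using W UV by (meson IntI openin_Int)
      then show "\<exists>y. y \<in> \<nu> ` ?A \<and> y \<in> W"
        by auto
    qed
    then have "?A \<in> e k"
      by (simp add: e_def)
    moreover have "l \<notin> K closure_of (\<nu> ` ?A)"
      unfolding in_closure_of using UV by (auto simp: disjnt_def)
    then have "?A \<notin> e l"
      by (simp add: e_def)
    ultimately show False
      using kl(3) by blast
  qed
  from transfer_equivariant_compactification[OF ec this] show ?thesis
    using that by blast
qed

lemma compactification_factor_trans:
  assumes "compactification_factor X K \<nu> K' \<nu>'" "compactification_factor X K' \<nu>' K'' \<nu>''"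
  shows "compactification_factor X K \<nu> K'' \<nu>''"
proof -
  obtain \<pi> \<rho> where "continuous_map K K' \<pi>" "\<forall>x\<in>topspace X. \<pi> (\<nu> x) = \<nu>' x"
      "continuous_map K' K'' \<rho>" "\<forall>x\<in>topspace X. \<rho> (\<nu>' x) = \<nu>'' x"
    using assms by (auto simp: compactification_factor_def)
  then show ?thesis
    unfolding compactification_factor_def
    by (intro exI[of _ "\<rho> \<circ> \<pi>"]) (simp add: continuous_map_compose)
qed

lemma maximal_equivariant_compactification_factor:
  fixes X :: "'x topology"
  assumes "maximal_equivariant_compactification G T X \<phi> K \<psi> \<nu>"
    and "equivariant_compactification G T X \<phi> K' \<psi>' \<nu>'"
  shows "compactification_factor X K \<nu> K' \<nu>'"
proof (rule equivariant_compactification_on_universe[OF assms(2)])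
  fix K2 :: "'x set set topology" and \<psi>2 \<nu>2
  assume "equivariant_compactification G T X \<phi> K2 \<psi>2 \<nu>2"
    and "compactification_equiv X K' \<nu>' K2 \<nu>2"
  then have "compactification_factor X K \<nu> K2 \<nu>2" "compactification_factor X K2 \<nu>2 K' \<nu>'"
    using assms(1) by (simp_all add: maximal_equivariant_compactification_def
        compactification_equiv_def)
  then show ?thesis
    by (rule compactification_factor_trans)
qed

lemma maximal_equivariant_compactification_exists:
  fixes X :: "'x topology"
  assumes GX: "G_space G T X \<phi>"
  shows "\<exists>(K :: 'x set set topology) \<psi> \<nu>. maximal_equivariant_compactification G T X \<phi> K \<psi> \<nu>"
proof -
  define I where "I = {(K :: 'x set set topology, \<psi>, \<nu>).
    equivariant_compactification G T X \<phi> K \<psi> \<nu>}"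
  define L where "L i = fst i" for i :: "'x set set topology \<times> ('a \<Rightarrow> 'x set set \<Rightarrow> 'x set set) \<times> ('x \<Rightarrow> 'x set set)"
  define a where "a i = fst (snd i)" for i :: "'x set set topology \<times> ('a \<Rightarrow> 'x set set \<Rightarrow> 'x set set) \<times> ('x \<Rightarrow> 'x set set)"
  define n where "n i = snd (snd i)" for i :: "'x set set topology \<times> ('a \<Rightarrow> 'x set set \<Rightarrow> 'x set set) \<times> ('x \<Rightarrow> 'x set set)"
  have I: "equivariant_compactification G T X \<phi> (L i) (a i) (n i)" if "i \<in> I" for i
    using that by (cases i) (simp add: I_def L_def a_def n_def)
  have IL: "compactification X (L i) (n i)" "G_space G T (L i) (a i)"
      "\<forall>g\<in>carrier G. \<forall>x\<in>topspace X. n i (\<phi> g x) = a i g (n i x)" if "i \<in> I" for i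
    using I[OF that] unfolding equivariant_compactification_def by - (elim conjE, assumption)+
  have L: "compact_space (L i)" "Hausdorff_space (L i)" "continuous_map X (L i) (n i)"
      "G_space G T (L i) (a i)"
    if "i \<in> I" for i
    using IL(1,2)[OF that] unfolding compactification_def by - (elim conjE, assumption)+
  have L5: "n i (\<phi> g x) = a i g (n i x)" if "i \<in> I" "g \<in> carrier G" "x \<in> topspace X" for i g x
    using IL(3) that by blast
  note act = G_spaceD[OF L(4)]
  define P where "P = product_topology L I"
  define \<delta> where "\<delta> x = (\<lambda>i\<in>I. n i x)" for x
  define C where "C = P closure_of (\<delta> ` topspace X)"
  define K where "K = subtopology P C"
  define b where "b g p = (\<lambda>i\<in>I. a i g (p i))" for g p
  define \<psi> where "\<psi> g = restrict (b g) C" for g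
  have topP: "topspace P = (\<Pi>\<^sub>E i\<in>I. topspace (L i))"
    by (simp add: P_def)
  have proj: "continuous_map P (L i) (\<lambda>p. p i)" if "i \<in> I" for i
    unfolding P_def using that by (rule continuous_map_product_projection)
  have \<delta>: "continuous_map X P \<delta>"
    unfolding P_def continuous_map_componentwise using L(3) by (auto simp: \<delta>_def)
  have CP: "C \<subseteq> topspace P"
    by (simp add: C_def closure_of_subset_topspace)
  have topK: "topspace K = C"
    using CP by (auto simp: K_def)
  have \<delta>C: "\<delta> x \<in> C" if "x \<in> topspace X" for x
  proof -
    have "\<delta> ` topspace X \<subseteq> topspace P"
      using \<delta> by (auto simp: continuous_map_def)
    then show ?thesis
      unfolding C_def using closure_of_subset that by fastforce
  qed
  have jointP: "continuous_map (prod_topology T P) P (\<lambda>q. b (fst q) (snd q))"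
    unfolding P_def continuous_map_componentwise
  proof (intro conjI ballI)
    fix i assume i: "i \<in> I"
    have "continuous_map (prod_topology T P) (prod_topology T (L i)) (\<lambda>q. (fst q, snd q i))"
      by (intro continuous_map_pairedI continuous_map_fst
            continuous_map_compose[OF continuous_map_snd proj[OF i], unfolded o_def])
    from continuous_map_compose[OF this act(6)[OF i]]
    show "continuous_map (prod_topology T (product_topology L I)) (L i) (\<lambda>q. b (fst q) (snd q) i)"
      using i by (simp add: o_def b_def P_def)
  qed (auto simp: b_def)
  have bcont: "continuous_map P P (b g)" if "g \<in> carrier G" for g
  proof -
    have "continuous_map P (prod_topology T P) (\<lambda>p. (g, p))"
      using that G_spaceD(2)[OF GX] by (intro continuous_map_pairedI) auto
    from continuous_map_compose[OF this jointP] show ?thesis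
      by (simp add: o_def)
  qed
  have b\<delta>: "b g (\<delta> x) = \<delta> (\<phi> g x)" if "g \<in> carrier G" "x \<in> topspace X" for g x
    using that by (auto simp: b_def \<delta>_def L5 fun_eq_iff)
  have bC: "b g p \<in> C" if "g \<in> carrier G" "p \<in> C" for g p
  proof -
    have "b g ` C \<subseteq> P closure_of (b g ` \<delta> ` topspace X)"
      unfolding C_def by (rule continuous_map_image_closure_subset[OF bcont[OF that(1)]])
    also have "\<dots> \<subseteq> C"
      unfolding C_def by (rule closure_of_mono) (use b\<delta> G_spaceD(3)[OF GX] that(1) in auto)
    finally show ?thesis
      using that(2) by blast
  qed
  have pL: "p i \<in> topspace (L i)" if "p \<in> C" "i \<in> I" for p i
    using that CP topP by auto
  have pE: "p \<in> extensional I" if "p \<in> C" for p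
    using that CP topP by (auto simp: PiE_def)
  have "group_action G (topspace K) \<psi>"
  proof (rule group_actionI)
    show "group G"
      by (rule G_spaceD(1)[OF GX])
    then interpret group G .
    show "\<psi> \<one>\<^bsub>G\<^esub> p = p" if "p \<in> topspace K" for p
      using that pE[of p] by (auto simp: topK \<psi>_def b_def act(4) pL extensional_def fun_eq_iff)
    show "\<psi> (g \<otimes>\<^bsub>G\<^esub> h) p = \<psi> g (\<psi> h p)"
      if "g \<in> carrier G" "h \<in> carrier G" "p \<in> topspace K" for g h p
    proof -
      have "b (g \<otimes>\<^bsub>G\<^esub> h) p = b g (b h p)"
        using that by (auto simp: topK b_def act(5) pL fun_eq_iff)
      then show ?thesis
        using that by (simp add: topK \<psi>_def bC)
    qed
  qed (auto simp: topK \<psi>_def bC)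
  moreover have "compact_space K" "Hausdorff_space K"
  proof -
    have "compact_space P"
      using L(1) by (auto simp: P_def compact_space_product_topology)
    then show "compact_space K"
      unfolding K_def C_def
      by (intro compact_space_subtopology closedin_compact_space closedin_closure_of)
    have "Hausdorff_space P"
      using L(2) by (auto simp: P_def Hausdorff_space_product_topology)
    then show "Hausdorff_space K"
      unfolding K_def by (rule Hausdorff_space_subtopology)
  qed
  moreover have "continuous_map (prod_topology T K) K (\<lambda>(g, p). \<psi> g p)"
  proof (rule continuous_map_eq)
    have "continuous_map (prod_topology T K) P (\<lambda>q. b (fst q) (snd q))"
    proof -
      have "continuous_map (prod_topology T K) (prod_topology T P) (\<lambda>q. (fst q, snd q))"
        unfolding K_def
        by (intro continuous_map_pairedI continuous_map_fst
              continuous_map_into_fulltopology[OF continuous_map_snd])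
      from continuous_map_compose[OF this jointP] show ?thesis
        by (simp add: o_def)
    qed
    then show "continuous_map (prod_topology T K) K (\<lambda>q. b (fst q) (snd q))"
      unfolding K_def continuous_map_in_subtopology
      using bC topK G_spaceD(2)[OF GX] by (auto simp: K_def)
  qed (auto simp: \<psi>_def topK)
  moreover have "continuous_map X K \<delta>"
    unfolding K_def continuous_map_in_subtopology using \<delta> \<delta>C by auto
  moreover have "K closure_of (\<delta> ` topspace X) = topspace K"
    unfolding K_def closure_of_subtopology_subset
    using \<delta>C CP by (auto simp: closure_of_subtopology Int_absorb1 image_subsetI C_def)
  moreover have "\<delta> (\<phi> g x) = \<psi> g (\<delta> x)" if "g \<in> carrier G" "x \<in> topspace X" for g x
    using that b\<delta> \<delta>C by (simp add: \<psi>_def)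
  ultimately have ec: "equivariant_compactification G T X \<phi> K \<psi> \<delta>"
    using GX by (simp add: equivariant_compactification_def compactification_def G_space_def
        compact_Hausdorff_completely_regular)
  have fac: "compactification_factor X K \<delta> K' \<nu>'"
    if "equivariant_compactification G T X \<phi> K' \<psi>' \<nu>'" for K' :: "'x set set topology" and \<psi>' \<nu>'
  proof -
    have i: "(K', \<psi>', \<nu>') \<in> I"
      using that by (simp add: I_def)
    have "continuous_map K K' (\<lambda>p. p (K', \<psi>', \<nu>'))"
      unfolding K_def using continuous_map_from_subtopology[OF proj[OF i]] by (simp add: L_def)
    then show ?thesis
      unfolding compactification_factor_def
      by (intro exI[of _ "\<lambda>p. p (K', \<psi>', \<nu>')"]) (use i in \<open>auto simp: \<delta>_def n_def\<close>)
  qed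
  obtain K2 :: "'x set set topology" and \<psi>2 \<nu>2 where
    "equivariant_compactification G T X \<phi> K2 \<psi>2 \<nu>2" "compactification_equiv X K \<delta> K2 \<nu>2"
    using equivariant_compactification_on_universe[OF ec] .
  then have K2: "equivariant_compactification G T X \<phi> K2 \<psi>2 \<nu>2"
      "compactification_factor X K2 \<nu>2 K \<delta>"
    by (simp_all add: compactification_equiv_def)
  have "maximal_equivariant_compactification G T X \<phi> K2 \<psi>2 \<nu>2"
    unfolding maximal_equivariant_compactification_def
  proof (intro conjI allI impI K2(1))
    fix K' :: "'x set set topology" and \<psi>' \<nu>'
    assume "equivariant_compactification G T X \<phi> K' \<psi>' \<nu>'"
    then show "compactification_factor X K2 \<nu>2 K' \<nu>'"
      by (rule compactification_factor_trans[OF K2(2) fac])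
  qed
  then show ?thesis
    by (intro exI)
qed

section \<open>Existence of the Gromov compactification\<close>

text \<open>The library's Stone-Weierstrass theorem needs a Hausdorff type; this covers \<^typ>\<open>'i \<Rightarrow> real\<close>.\<close>

lemma open_coordinate: "open U \<Longrightarrow> open {h :: 'a \<Rightarrow> 'b::topological_space. h x \<in> U}"
  using open_vimage[OF _ continuous_on_product_coordinates] by (simp add: vimage_def)

instance "fun" :: (type, t0_space) t0_space
proof
  fix f g :: "'a \<Rightarrow> 'b" assume "f \<noteq> g"
  then obtain x where x: "f x \<noteq> g x"
    by (meson ext)
  then obtain U where "open U" "\<not> (f x \<in> U \<longleftrightarrow> g x \<in> U)"
    using separation_t0[THEN iffD1, OF x] by metis
  then show "\<exists>U. open U \<and> \<not> (f \<in> U \<longleftrightarrow> g \<in> U)"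
    by (intro exI[of _ "{h. h x \<in> U}"]) (simp add: open_coordinate)
qed

instance "fun" :: (type, t1_space) t1_space
proof
  fix f g :: "'a \<Rightarrow> 'b" assume "f \<noteq> g"
  then obtain x where x: "f x \<noteq> g x"
    by (meson ext)
  then obtain U where "open U" "f x \<in> U" "g x \<notin> U"
    using separation_t1[THEN iffD1, OF x] by metis
  then show "\<exists>U. open U \<and> f \<in> U \<and> g \<notin> U"
    by (intro exI[of _ "{h. h x \<in> U}"]) (simp add: open_coordinate)
qed

instance "fun" :: (type, t2_space) t2_space
proof
  fix f g :: "'a \<Rightarrow> 'b" assume "f \<noteq> g"
  then obtain x where x: "f x \<noteq> g x"
    by (meson ext)
  then obtain U V where "open U" "open V" "f x \<in> U" "g x \<in> V" "U \<inter> V = {}"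
    using separation_t2[THEN iffD1, OF x] by metis
  then show "\<exists>U V. open U \<and> open V \<and> f \<in> U \<and> g \<in> V \<and> U \<inter> V = {}"
    by (intro exI[of _ "{h. h x \<in> U}"] exI[of _ "{h. h x \<in> V}"]) (auto simp: open_coordinate)
qed

lemma compactification_of_algebra_exists:
  fixes X :: "'x topology"
  assumes A: "closed_unital_subalgebra X A"
  shows "\<exists>(K :: (('x \<Rightarrow> real) \<Rightarrow> real) topology) \<nu>. compactification_of_algebra X A K \<nu>"
proof -
  define M where "M = topspace X"
  define \<nu> where "\<nu> x f = (if f \<in> A then f x else 0)" for x and f :: "'x \<Rightarrow> real"
  define S where "S = closure (\<nu> ` M)"
  define K where "K = top_of_set S"
  have AC: "continuous_map X euclideanreal f" "bounded (f ` M)" "f \<in> extensional M" if "f \<in> A" for f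
    using A that by (auto simp: closed_unital_subalgebra_def bounded_continuous_functions_def M_def)
  have Aadd: "(\<lambda>x\<in>M. f x + g x) \<in> A" and Amult: "(\<lambda>x\<in>M. f x * g x) \<in> A"
    and Ascale: "(\<lambda>x\<in>M. c * f x) \<in> A" if "f \<in> A" "g \<in> A" for f g c
    using A that by (auto simp: closed_unital_subalgebra_def M_def)
  have one: "(\<lambda>x\<in>M. 1) \<in> A"
    using A by (auto simp: closed_unital_subalgebra_def M_def)
  have Aconst: "(\<lambda>x\<in>M. c) \<in> A" for c
    using Ascale[OF one one, of c] by (simp cong: restrict_cong)
  have Alim: "f \<in> A" if "\<And>n. s n \<in> A" "f \<in> extensional M" "uniform_limit M s f sequentially" for s f
    using A that unfolding closed_unital_subalgebra_def M_def by blast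
  have coord: "continuous_on UNIV (\<lambda>p :: ('x \<Rightarrow> real) \<Rightarrow> real. p f)" for f
    by (rule continuous_on_product_coordinates)
  have \<nu>cont: "continuous_map X euclidean \<nu>"
    unfolding euclidean_product_topology[symmetric] continuous_map_componentwise_UNIV
    using AC(1) by (auto simp: \<nu>_def)
  have "\<exists>B. \<forall>x\<in>M. \<bar>\<nu> x f\<bar> \<le> B" for f
    using AC(2)[of f] by (auto simp: \<nu>_def bounded_iff)
  then obtain B where B: "\<And>f x. x \<in> M \<Longrightarrow> \<bar>\<nu> x f\<bar> \<le> B f"
    by metis
  define Q where "Q = (\<Pi>\<^sub>E f\<in>UNIV. {- B f .. B f})"
  have "compactin (product_topology (\<lambda>_. euclideanreal) UNIV) Q"
    unfolding Q_def by (subst compactin_PiE) (simp add: compactin_euclidean_iff)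
  then have Qc: "compact Q"
    by (simp add: euclidean_product_topology flip: compactin_euclidean_iff)
  have "closedin (product_topology (\<lambda>_. euclideanreal) UNIV) Q"
    unfolding Q_def by (subst closedin_product_topology) simp
  then have "closed Q"
    by (simp add: euclidean_product_topology flip: closed_closedin)
  moreover have "\<nu> ` M \<subseteq> Q"
    using B by (auto simp: Q_def abs_le_iff minus_le_iff)
  ultimately have "S \<subseteq> Q"
    unfolding S_def by (simp add: closure_minimal)
  then have S: "compact S"
    using Qc compact_Int_closed[of Q S] by (simp add: S_def Int_absorb1)
  have \<nu>S: "\<nu> x \<in> S" if "x \<in> M" for x
    unfolding S_def using that closure_subset[of "\<nu> ` M"] by blast
  have compK: "compactification X K \<nu>"
    unfolding compactification_def
  proof (intro conjI)
    show "compact_space K"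
      using S by (simp add: K_def compact_space_subtopology compactin_euclidean_iff)
    show "Hausdorff_space K"
      unfolding K_def euclidean_product_topology[symmetric]
      by (intro Hausdorff_space_subtopology) (simp add: Hausdorff_space_product_topology)
    show "continuous_map X K \<nu>"
      unfolding K_def continuous_map_in_subtopology using \<nu>cont \<nu>S by (auto simp: M_def)
    have "\<nu> ` M \<subseteq> S"
      using \<nu>S by blast
    then show "K closure_of (\<nu> ` topspace X) = topspace K"
      by (simp add: K_def closure_of_subtopology Int_absorb1 S_def flip: M_def)
  qed
  have sub: "(\<lambda>x\<in>M. h (\<nu> x)) \<in> A" if h: "continuous_map K euclideanreal h" for h
  proof -
    define R where "R = {h. continuous_on S h \<and> (\<lambda>x\<in>M. h (\<nu> x)) \<in> A}"
    interpret function_ring_on R S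
    proof
      show "compact S" by fact
      show "continuous_on S f" if "f \<in> R" for f
        using that by (simp add: R_def)
      show "(\<lambda>x. f x + g x) \<in> R" if "f \<in> R" "g \<in> R" for f g
        using that Aadd[of "\<lambda>x\<in>M. f (\<nu> x)" "\<lambda>x\<in>M. g (\<nu> x)"]
        by (auto simp: R_def intro!: continuous_intros cong: restrict_cong)
      show "(\<lambda>x. f x * g x) \<in> R" if "f \<in> R" "g \<in> R" for f g
        using that Amult[of "\<lambda>x\<in>M. f (\<nu> x)" "\<lambda>x\<in>M. g (\<nu> x)"]
        by (auto simp: R_def intro!: continuous_intros cong: restrict_cong)
      show "(\<lambda>_. c) \<in> R" for c
        using Aconst by (simp add: R_def)
      show "\<exists>f\<in>R. f p \<noteq> f q" if pq: "p \<in> S" "q \<in> S" "p \<noteq> q" for p q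
      proof -
        obtain f where f: "p f \<noteq> q f"
          using pq(3) by (meson ext)
        have "f \<in> A"
        proof (rule ccontr)
          assume "f \<notin> A"
          moreover have "closed {p :: ('x \<Rightarrow> real) \<Rightarrow> real. p f = 0}"
            by (rule closed_Collect_eq) (auto intro: coord)
          ultimately have "S \<subseteq> {p. p f = 0}"
            unfolding S_def by (intro closure_minimal) (auto simp: \<nu>_def)
          with pq have "p f = 0" "q f = 0"
            by blast+
          with f show False
            by simp
        qed
        moreover have "continuous_on S (\<lambda>p :: ('x \<Rightarrow> real) \<Rightarrow> real. p f)"
          using coord continuous_on_subset by blast
        ultimately have "(\<lambda>p. p f) \<in> R"
          using AC(3) by (simp add: R_def \<nu>_def extensional_restrict)
        with f show ?thesis
          by (intro bexI[of _ "\<lambda>p. p f"]) simp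
      qed
    qed
    have hS: "continuous_on S h"
      using h by (simp add: K_def)
    have "\<exists>g\<in>R. \<forall>p\<in>S. \<bar>h p - g p\<bar> < 1 / real (Suc n)" for n
      using Stone_Weierstrass_basic[OF hS, of "1 / real (Suc n)"] by auto
    then obtain g where g: "\<And>n. g n \<in> R" "\<And>n p. p \<in> S \<Longrightarrow> \<bar>h p - g n p\<bar> < 1 / real (Suc n)"
      by metis
    show ?thesis
    proof (rule Alim)
      show "(\<lambda>x\<in>M. g n (\<nu> x)) \<in> A" for n
        using g(1) by (simp add: R_def)
      show "uniform_limit M (\<lambda>n. \<lambda>x\<in>M. g n (\<nu> x)) (\<lambda>x\<in>M. h (\<nu> x)) sequentially"
      proof (rule uniform_limitI)
        fix e :: real assume "e > 0"
        then obtain N where N: "1 / real (Suc N) < e"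
          using nat_approx_posE by blast
        show "\<forall>\<^sub>F n in sequentially. \<forall>x\<in>M.
            dist ((\<lambda>x\<in>M. g n (\<nu> x)) x) ((\<lambda>x\<in>M. h (\<nu> x)) x) < e"
          unfolding eventually_sequentially
        proof (intro exI[of _ N] allI impI ballI)
          fix n x assume n: "N \<le> n" and x: "x \<in> M"
          have "\<bar>h (\<nu> x) - g n (\<nu> x)\<bar> < 1 / real (Suc n)"
            using g(2) \<nu>S x by blast
          also have "\<dots> \<le> 1 / real (Suc N)"
            using n by (simp add: frac_le)
          finally show "dist ((\<lambda>x\<in>M. g n (\<nu> x)) x) ((\<lambda>x\<in>M. h (\<nu> x)) x) < e"
            using N x by (simp add: dist_real_def abs_minus_commute)
        qed
      qed
    qed simp
  qed
  have sup: "\<exists>h. f = (\<lambda>x\<in>M. h (\<nu> x)) \<and> continuous_map K euclideanreal h" if "f \<in> A" for f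
  proof (intro exI conjI)
    show "f = (\<lambda>x\<in>M. (\<nu> x) f)"
      using that AC(3) by (simp add: \<nu>_def extensional_restrict)
    show "continuous_map K euclideanreal (\<lambda>p. p f)"
      using continuous_on_subset[OF coord[of f], of S] by (simp add: K_def)
  qed
  have "compactification_of_algebra X A K \<nu>"
    unfolding compactification_of_algebra_def using compK sub sup by (auto simp: M_def)
  then show ?thesis
    by blast
qed

lemma bounded_continuous_functions_iff:
  "f \<in> bounded_continuous_functions X \<longleftrightarrow>
     f \<in> extensional (topspace X) \<and> continuous_map X euclideanreal f \<and>
     (\<exists>B. \<forall>x\<in>topspace X. \<bar>f x\<bar> \<le> B)"
  by (auto simp: bounded_continuous_functions_def bounded_iff)

lemma bounded_continuous_functions_restrict:
  assumes "continuous_map X euclideanreal f" "\<And>x. x \<in> topspace X \<Longrightarrow> \<bar>f x\<bar> \<le> B"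
  shows "(\<lambda>x\<in>topspace X. f x) \<in> bounded_continuous_functions X"
proof -
  have "continuous_map X euclideanreal (\<lambda>x\<in>topspace X. f x)"
    by (rule continuous_map_eq[OF assms(1)]) simp
  then show ?thesis
    using assms(2) by (auto simp: bounded_continuous_functions_iff)
qed

lemma closed_unital_subalgebra_generated:
  assumes "F \<subseteq> bounded_continuous_functions X"
  shows "closed_unital_subalgebra X (generated_closed_unital_subalgebra X F)"
proof -
  have "closed_unital_subalgebra X (bounded_continuous_functions X)"
    unfolding closed_unital_subalgebra_def
  proof (intro conjI ballI allI impI; (elim conjE)?)
    show "(\<lambda>x\<in>topspace X. 1) \<in> bounded_continuous_functions X"
      by (rule bounded_continuous_functions_restrict[where B = 1]) auto
  next
    fix f g assume "f \<in> bounded_continuous_functions X" "g \<in> bounded_continuous_functions X"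
    then obtain a b where fg: "continuous_map X euclideanreal f" "continuous_map X euclideanreal g"
      and ab: "\<And>x. x \<in> topspace X \<Longrightarrow> \<bar>f x\<bar> \<le> a" "\<And>x. x \<in> topspace X \<Longrightarrow> \<bar>g x\<bar> \<le> b"
      by (auto simp: bounded_continuous_functions_iff)
    have "\<bar>f x + g x\<bar> \<le> a + b" if "x \<in> topspace X" for x
      using ab[OF that] by linarith
    with fg show "(\<lambda>x\<in>topspace X. f x + g x) \<in> bounded_continuous_functions X"
      by (intro bounded_continuous_functions_restrict[where B = "a + b"] continuous_map_add)
    have "\<bar>f x * g x\<bar> \<le> a * b" if "x \<in> topspace X" for x
      using ab[OF that] by (simp add: abs_mult mult_mono)
    with fg show "(\<lambda>x\<in>topspace X. f x * g x) \<in> bounded_continuous_functions X"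
      by (intro bounded_continuous_functions_restrict[where B = "a * b"] continuous_map_real_mult)
  next
    fix c f assume "f \<in> bounded_continuous_functions X"
    then obtain a where f: "continuous_map X euclideanreal f"
      and a: "\<And>x. x \<in> topspace X \<Longrightarrow> \<bar>f x\<bar> \<le> a"
      by (auto simp: bounded_continuous_functions_iff)
    have "\<bar>c * f x\<bar> \<le> \<bar>c\<bar> * a" if "x \<in> topspace X" for x
      using a[OF that] by (simp add: abs_mult mult_left_mono)
    with f show "(\<lambda>x\<in>topspace X. c * f x) \<in> bounded_continuous_functions X"
      by (intro bounded_continuous_functions_restrict[where B = "\<bar>c\<bar> * a"]
          continuous_map_real_mult_left)
  next
    fix s f
    assume s: "\<forall>n. s n \<in> bounded_continuous_functions X" and ext: "f \<in> extensional (topspace X)"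
      and lim: "uniform_limit (topspace X) s f sequentially"
    have unif: "\<forall>\<^sub>F n in sequentially. \<forall>x\<in>topspace X. dist (s n x) (f x) < e" if "e > 0" for e
      using lim that by (rule uniform_limitD)
    have "continuous_map X Met_TC.mtopology f"
    proof (rule Met_TC.continuous_map_uniform_limit[where F = sequentially and f = s])
      show "\<forall>\<^sub>F n in sequentially. continuous_map X Met_TC.mtopology (s n)"
        using s by (simp add: bounded_continuous_functions_iff)
    qed (use unif in auto)
    moreover obtain n where n: "\<forall>x\<in>topspace X. dist (s n x) (f x) < 1"
      using unif[of 1] by (auto simp: eventually_sequentially)
    obtain a where a: "\<forall>x\<in>topspace X. \<bar>s n x\<bar> \<le> a"
      using s by (auto simp: bounded_continuous_functions_iff)
    have "\<bar>f x\<bar> \<le> a + 1" if "x \<in> topspace X" for x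
      using n a that by (fastforce simp: dist_real_def abs_le_iff abs_less_iff)
    ultimately show "f \<in> bounded_continuous_functions X"
      using ext by (auto simp: bounded_continuous_functions_iff)
  qed auto
  then have gen: "generated_closed_unital_subalgebra X F \<subseteq> bounded_continuous_functions X"
    unfolding generated_closed_unital_subalgebra_def using assms by blast
  have lim: "f \<in> generated_closed_unital_subalgebra X F"
    if s: "\<forall>n. s n \<in> generated_closed_unital_subalgebra X F" "f \<in> extensional (topspace X)"
      "uniform_limit (topspace X) s f sequentially" for s f
    unfolding generated_closed_unital_subalgebra_def
  proof clarify
    fix A assume A: "closed_unital_subalgebra X A" "F \<subseteq> A"
    then have "\<forall>n. s n \<in> A"
      using s(1) unfolding generated_closed_unital_subalgebra_def by blast
    with A(1) s(2,3) show "f \<in> A"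
      unfolding closed_unital_subalgebra_def by metis
  qed
  show ?thesis
    unfolding closed_unital_subalgebra_def
  proof (intro conjI gen)
    show "\<forall>s f. (\<forall>n. s n \<in> generated_closed_unital_subalgebra X F) \<and> f \<in> extensional (topspace X) \<and>
        uniform_limit (topspace X) s f sequentially \<longrightarrow> f \<in> generated_closed_unital_subalgebra X F"
      using lim by metis
    show "(\<lambda>x\<in>topspace X. 1) \<in> generated_closed_unital_subalgebra X F"
      by (simp add: generated_closed_unital_subalgebra_def closed_unital_subalgebra_def)
    have op: "u \<in> generated_closed_unital_subalgebra X F"
      if "\<And>A. closed_unital_subalgebra X A \<Longrightarrow> f \<in> A \<Longrightarrow> g \<in> A \<Longrightarrow> u \<in> A"
        "f \<in> generated_closed_unital_subalgebra X F" "g \<in> generated_closed_unital_subalgebra X F"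
      for u f g
      using that unfolding generated_closed_unital_subalgebra_def by blast
    show "\<forall>f\<in>generated_closed_unital_subalgebra X F. \<forall>g\<in>generated_closed_unital_subalgebra X F.
        (\<lambda>x\<in>topspace X. f x + g x) \<in> generated_closed_unital_subalgebra X F"
    proof (intro ballI)
      fix f g assume "f \<in> generated_closed_unital_subalgebra X F" "g \<in> generated_closed_unital_subalgebra X F"
      then show "(\<lambda>x\<in>topspace X. f x + g x) \<in> generated_closed_unital_subalgebra X F"
        by (rule op[rotated]) (simp add: closed_unital_subalgebra_def)
    qed
    show "\<forall>f\<in>generated_closed_unital_subalgebra X F. \<forall>g\<in>generated_closed_unital_subalgebra X F.
        (\<lambda>x\<in>topspace X. f x * g x) \<in> generated_closed_unital_subalgebra X F"
    proof (intro ballI)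
      fix f g assume "f \<in> generated_closed_unital_subalgebra X F" "g \<in> generated_closed_unital_subalgebra X F"
      then show "(\<lambda>x\<in>topspace X. f x * g x) \<in> generated_closed_unital_subalgebra X F"
        by (rule op[rotated]) (simp add: closed_unital_subalgebra_def)
    qed
    show "\<forall>c. \<forall>f\<in>generated_closed_unital_subalgebra X F.
        (\<lambda>x\<in>topspace X. c * f x) \<in> generated_closed_unital_subalgebra X F"
    proof (intro allI ballI)
      fix c f assume f: "f \<in> generated_closed_unital_subalgebra X F"
      show "(\<lambda>x\<in>topspace X. c * f x) \<in> generated_closed_unital_subalgebra X F"
        by (rule op[OF _ f f]) (simp add: closed_unital_subalgebra_def)
    qed
  qed
qed

lemma mtopology_sphere:
  "Metric_space.mtopology (unit_sphere :: 'a::real_normed_vector set) dist = top_of_set unit_sphere"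
proof -
  interpret Submetric UNIV dist "unit_sphere :: 'a set"
    by unfold_locales auto
  show ?thesis
    using mtopology_submetric by simp
qed

lemma gromov_compactification_sphere_exists:
  "\<exists>(K :: (('a::real_normed_vector \<Rightarrow> real) \<Rightarrow> real) topology) (\<nu> :: 'a \<Rightarrow> _).
     gromov_compactification unit_sphere dist K \<nu>"
proof -
  have "(\<lambda>x\<in>unit_sphere. dist x z) \<in> bounded_continuous_functions (top_of_set unit_sphere)"
    if z: "z \<in> unit_sphere" for z :: 'a
  proof -
    have "\<bar>dist x z\<bar> \<le> 2" if "x \<in> unit_sphere" for x
      using that z norm_triangle_ineq4[of x z] by (simp add: dist_norm)
    moreover have "continuous_on unit_sphere (\<lambda>x. dist x z)"
      by (intro continuous_intros)
    ultimately show ?thesis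
      using bounded_continuous_functions_restrict[of "top_of_set unit_sphere" "\<lambda>x. dist x z" 2]
      by simp
  qed
  then have "{(\<lambda>x\<in>unit_sphere. dist x z) |z :: 'a. z \<in> unit_sphere}
      \<subseteq> bounded_continuous_functions (top_of_set unit_sphere)"
    by blast
  from compactification_of_algebra_exists[OF closed_unital_subalgebra_generated[OF this]]
  show ?thesis
    unfolding gromov_compactification_def mtopology_sphere .
qed

section \<open>The unit sphere as a G-space\<close>

lemma Aut_iff:
  "T \<in> carrier Aut \<longleftrightarrow> (\<forall>x. norm (blinfun_apply T x) = norm x) \<and> surj (blinfun_apply T)"
  by (simp add: Aut_def)

lemma Aut_inverse:
  fixes T :: "'a::real_normed_vector \<Rightarrow>\<^sub>L 'a"
  assumes "T \<in> carrier Aut"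
  obtains S where "S \<in> carrier Aut" "S o\<^sub>L T = id_blinfun" "T o\<^sub>L S = id_blinfun"
proof -
  have n: "norm (T x) = norm x" and s: "surj (blinfun_apply T)" for x
    using assms by (auto simp: Aut_iff)
  have "inj (blinfun_apply T)"
  proof (rule injI)
    fix x y assume "T x = T y"
    then have "norm (T (x - y)) = 0"
      by (simp add: blinfun.diff_right)
    then show "x = y"
      by (simp add: n)
  qed
  then have l: "inv_into UNIV (blinfun_apply T) (T x) = x" for x
    by simp
  have r: "T (inv_into UNIV (blinfun_apply T) x) = x" for x
    using s by (simp add: surj_f_inv_f)
  have ni: "norm (inv_into UNIV (blinfun_apply T) x) = norm x" for x
    by (metis n r)
  have "bounded_linear (inv_into UNIV (blinfun_apply T))"
  proof (rule bounded_linear_intro[where K = 1])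
    show "inv_into UNIV (blinfun_apply T) (x + y) = inv_into UNIV (blinfun_apply T) x + inv_into UNIV (blinfun_apply T) y" for x y
      by (metis l r blinfun.add_right)
    show "inv_into UNIV (blinfun_apply T) (c *\<^sub>R x) = c *\<^sub>R inv_into UNIV (blinfun_apply T) x" for c x
      by (metis l r blinfun.scaleR_right)
  qed (simp add: ni)
  then have a: "blinfun_apply (Blinfun (inv_into UNIV (blinfun_apply T))) = inv_into UNIV (blinfun_apply T)"
    by (rule bounded_linear_Blinfun_apply)
  show ?thesis
  proof (rule that)
    show "Blinfun (inv_into UNIV (blinfun_apply T)) \<in> carrier Aut"
      unfolding Aut_iff a using ni l by (metis surjI)
  qed (auto intro!: blinfun_eqI simp: a l r)
qed

lemma group_Aut: "group (Aut :: ('a::real_normed_vector \<Rightarrow>\<^sub>L 'a) monoid)"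
proof (rule groupI)
  fix S T :: "'a \<Rightarrow>\<^sub>L 'a" assume "S \<in> carrier Aut" "T \<in> carrier Aut"
  then show "S \<otimes>\<^bsub>Aut\<^esub> T \<in> carrier Aut"
    using comp_surj[of "blinfun_apply T" "blinfun_apply S"] by (auto simp: Aut_def o_def)
next
  fix T :: "'a \<Rightarrow>\<^sub>L 'a" assume "T \<in> carrier Aut"
  then show "\<exists>S\<in>carrier Aut. S \<otimes>\<^bsub>Aut\<^esub> T = \<one>\<^bsub>Aut\<^esub>"
  proof (rule Aut_inverse)
    fix S :: "'a \<Rightarrow>\<^sub>L 'a" assume "S \<in> carrier Aut" "S o\<^sub>L T = id_blinfun"
    then show ?thesis
      by (intro bexI[of _ S]) (simp_all add: Aut_def)
  qed
next
  show "\<one>\<^bsub>Aut\<^esub> \<in> carrier (Aut :: ('a \<Rightarrow>\<^sub>L 'a) monoid)"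
    by (simp add: Aut_def surj_id[unfolded id_def])
next
  fix R S T :: "'a \<Rightarrow>\<^sub>L 'a"
  show "R \<otimes>\<^bsub>Aut\<^esub> S \<otimes>\<^bsub>Aut\<^esub> T = R \<otimes>\<^bsub>Aut\<^esub> (S \<otimes>\<^bsub>Aut\<^esub> T)"
    by (rule blinfun_eqI) (simp add: Aut_def)
next
  fix T :: "'a \<Rightarrow>\<^sub>L 'a"
  show "\<one>\<^bsub>Aut\<^esub> \<otimes>\<^bsub>Aut\<^esub> T = T"
    by (rule blinfun_eqI) (simp add: Aut_def)
qed

lemma topspace_Aut_topology [simp]: "topspace Aut_topology = carrier Aut"
  by (simp add: Aut_topology_def strong_operator_topology_topspace)

lemma continuous_map_into_Aut_topology:
  "continuous_map Y Aut_topology f \<longleftrightarrow>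
     (\<forall>x. continuous_map Y euclidean (\<lambda>y. blinfun_apply (f y) x)) \<and> f \<in> topspace Y \<rightarrow> carrier Aut"
  by (simp add: Aut_topology_def continuous_map_in_subtopology
      continuous_on_strong_operator_topo_iff_coordinatewise image_subset_iff_funcset)

lemma continuous_map_Aut_apply:
  fixes f :: "'y \<Rightarrow> 'a::real_normed_vector \<Rightarrow>\<^sub>L 'a"
  assumes f: "continuous_map Y Aut_topology f" and g: "continuous_map Y euclidean g"
  shows "continuous_map Y euclidean (\<lambda>y. blinfun_apply (f y) (g y))"
proof -
  have "\<exists>U. openin Y U \<and> y \<in> U \<and> (\<forall>w\<in>U. dist (f w (g w)) (f y (g y)) < e)"
    if y: "y \<in> topspace Y" and e: "e > 0" for y and e :: real
  proof -
    define U where "U = {w \<in> topspace Y. g w \<in> ball (g y) (e / 2)} \<inter>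
        {w \<in> topspace Y. f w (g y) \<in> ball (f y (g y)) (e / 2)}"
    have "continuous_map Y euclidean (\<lambda>w. f w (g y))"
      using f by (simp add: continuous_map_into_Aut_topology)
    then have "openin Y U"
      unfolding U_def using g
      by (intro openin_Int openin_continuous_map_preimage[where Y = euclidean]) auto
    moreover have "y \<in> U"
      using y e by (simp add: U_def)
    moreover have "dist (f w (g w)) (f y (g y)) < e" if w: "w \<in> U" for w
    proof -
      have "f w \<in> carrier Aut"
        using w f by (auto simp: U_def continuous_map_into_Aut_topology)
      then have "dist (f w (g w)) (f w (g y)) = dist (g w) (g y)"
        by (simp add: Aut_iff dist_norm flip: blinfun.diff_right)
      moreover have "dist (g w) (g y) < e / 2" "dist (f w (g y)) (f y (g y)) < e / 2"
        using w by (auto simp: U_def dist_commute)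
      ultimately show ?thesis
        using dist_triangle[of "f w (g w)" "f y (g y)" "f w (g y)"] by linarith
    qed
    ultimately show ?thesis
      by blast
  qed
  then show ?thesis
    using Met_TC.continuous_map_to_metric[of Y "\<lambda>y. f y (g y)"]
    by (auto simp: dist_commute)
qed

lemma topological_group_Aut:
  "topological_group (Aut :: ('a::real_normed_vector \<Rightarrow>\<^sub>L 'a) monoid) Aut_topology"
proof -
  interpret group "Aut :: ('a \<Rightarrow>\<^sub>L 'a) monoid"
    by (rule group_Aut)
  have mult: "continuous_map (prod_topology Aut_topology Aut_topology) Aut_topology
      (\<lambda>(S, T). S \<otimes>\<^bsub>Aut\<^esub> T :: 'a \<Rightarrow>\<^sub>L 'a)"
    unfolding continuous_map_into_Aut_topology
  proof (intro conjI allI)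
    fix x :: 'a
    have "continuous_map (prod_topology Aut_topology Aut_topology) euclidean
        (\<lambda>p. blinfun_apply (fst p) (blinfun_apply (snd p) x))"
      by (intro continuous_map_Aut_apply continuous_map_fst continuous_map_snd) simp
    then show "continuous_map (prod_topology Aut_topology Aut_topology) euclidean
        (\<lambda>y. blinfun_apply (case y of (S, T) \<Rightarrow> S \<otimes>\<^bsub>Aut\<^esub> T) x)"
      by (simp add: case_prod_beta Aut_def)
  qed auto
  have inverse: "continuous_map Aut_topology Aut_topology (\<lambda>T. inv\<^bsub>Aut\<^esub> T :: 'a \<Rightarrow>\<^sub>L 'a)"
    unfolding continuous_map_into_Aut_topology
  proof (intro conjI allI)
    fix x :: 'a
    have app: "blinfun_apply T (blinfun_apply (inv\<^bsub>Aut\<^esub> T) y) = y"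
      if "T \<in> carrier Aut" for T :: "'a \<Rightarrow>\<^sub>L 'a" and y
    proof -
      have "T o\<^sub>L inv\<^bsub>Aut\<^esub> T = id_blinfun"
        using r_inv[OF that] by (simp add: Aut_def)
      then show ?thesis
        by (metis blinfun_apply_blinfun_compose blinfun_apply_id_blinfun id_apply)
    qed
    have d: "dist (blinfun_apply (inv\<^bsub>Aut\<^esub> S) x) (blinfun_apply (inv\<^bsub>Aut\<^esub> T) x)
        = dist (blinfun_apply S (blinfun_apply (inv\<^bsub>Aut\<^esub> T) x)) x"
      if "S \<in> carrier Aut" "T \<in> carrier Aut" for S T :: "'a \<Rightarrow>\<^sub>L 'a"
    proof -
      have "dist (blinfun_apply (inv\<^bsub>Aut\<^esub> S) x) (blinfun_apply (inv\<^bsub>Aut\<^esub> T) x)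
          = norm (blinfun_apply S (blinfun_apply (inv\<^bsub>Aut\<^esub> S) x - blinfun_apply (inv\<^bsub>Aut\<^esub> T) x))"
        using that by (simp add: Aut_iff dist_norm)
      then show ?thesis
        using that by (simp add: blinfun.diff_right app dist_norm norm_minus_commute)
    qed
    have "\<exists>U. openin Aut_topology U \<and> T \<in> U \<and>
        (\<forall>S\<in>U. dist (blinfun_apply (inv\<^bsub>Aut\<^esub> S) x) (blinfun_apply (inv\<^bsub>Aut\<^esub> T) x) < e)"
      if T: "T \<in> carrier Aut" and e: "e > 0" for T :: "'a \<Rightarrow>\<^sub>L 'a" and e :: real
    proof (intro exI conjI ballI)
      let ?U = "{S \<in> topspace Aut_topology. blinfun_apply S (blinfun_apply (inv\<^bsub>Aut\<^esub> T) x) \<in> ball x e}"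
      have "continuous_map Aut_topology euclidean (\<lambda>S. blinfun_apply S (blinfun_apply (inv\<^bsub>Aut\<^esub> T) x))"
        by (rule continuous_map_Aut_apply) simp_all
      then show "openin Aut_topology ?U"
        by (rule openin_continuous_map_preimage) simp
      show "T \<in> ?U"
        using T e by (simp add: app)
      show "dist (blinfun_apply (inv\<^bsub>Aut\<^esub> S) x) (blinfun_apply (inv\<^bsub>Aut\<^esub> T) x) < e" if "S \<in> ?U" for S
        using that T by (auto simp: d dist_commute)
    qed
    then show "continuous_map Aut_topology euclidean (\<lambda>T. blinfun_apply (inv\<^bsub>Aut\<^esub> T) x)"
      using Met_TC.continuous_map_to_metric[of Aut_topology "\<lambda>T. blinfun_apply (inv\<^bsub>Aut\<^esub> T) x"]
      by (auto simp: dist_commute)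
  qed auto
  show ?thesis
    unfolding topological_group_def using group_Aut mult inverse by auto
qed

lemma G_space_sphere:
  "G_space (Aut :: ('a::real_normed_vector \<Rightarrow>\<^sub>L 'a) monoid) Aut_topology
     (top_of_set unit_sphere) sphere_action"
proof -
  have "group_action (Aut :: ('a \<Rightarrow>\<^sub>L 'a) monoid) unit_sphere sphere_action"
    by (rule group_actionI[OF group_Aut]) (auto simp: sphere_action_def Aut_def)
  moreover have "continuous_map (prod_topology Aut_topology (top_of_set unit_sphere))
      (top_of_set (unit_sphere :: 'a set)) (\<lambda>(T, x). sphere_action T x)"
  proof (rule continuous_map_eq)
    have "continuous_map (prod_topology Aut_topology (top_of_set unit_sphere)) euclidean
        (\<lambda>p. blinfun_apply (fst p) (snd p :: 'a))"
      by (intro continuous_map_Aut_apply continuous_map_fst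
            continuous_map_into_fulltopology[OF continuous_map_snd])
    then show "continuous_map (prod_topology Aut_topology (top_of_set unit_sphere))
        (top_of_set unit_sphere) (\<lambda>p. blinfun_apply (fst p) (snd p :: 'a))"
      unfolding continuous_map_in_subtopology by (auto simp: Aut_iff)
  qed (auto simp: sphere_action_def)
  moreover have "completely_regular_space (top_of_set (unit_sphere :: 'a set))"
    by (intro metrizable_imp_completely_regular_space metrizable_space_subtopology
        metrizable_space_euclidean)
  ultimately show ?thesis
    using topological_group_Aut by (simp add: G_space_def Hausdorff_space_subtopology)
qed

end

(*
  The map sending x in the sphere to its profile e |-> |x + e| has relatively compact image in the
  product of real lines, and the closure of the image is a metrizable equivariant compactification:
  its points are 1-Lipschitz functions on a separable space. By maximality K maps onto it, and K is
  metrizable once this map is injective. Injectivity comes from homogeneity: for a finite set F, a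
  profile restricted to span F is realized, up to a small relative error, by a point x of the
  sphere, and every point of the sphere whose profile is close to the given one on a suitable finite
  set is moved near x by an automorphism almost fixing F. Continuous functions on K are almost
  invariant under such automorphisms, so they cannot separate two points with the same profile.

  The Gromov compactification only knows the distances to points of the sphere. Two extensions of the
  norm by one unit vector have constant distance 3/2 from the sphere but distances 2 and 5/2 from the
  vectors of norm 2. Hence x |-> |x - 2z| with |z| = 1, which extends to K, does not extend to the
  Gromov compactification.
*)

theory Submission
  imports Defs
begin

section \<open>Norm extensions realized in the Gurarij space\<close>

text \<open>The two properties of the space do not fit together directly. Universality embeds a
  finite-dimensional normed space somewhere, without regard to a given subspace, and homogeneity
  moves a copy of that subspace back to its place only up to an error on finitely many vectors. So
  the constructions share one shape: put a norm on \<open>'g \<times> real\<close> or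
  \<open>'g \<times> 'g\<close> that extends the given one, embed the span of finitely many vectors
  by some \<open>J\<close>, and pull back by automorphisms that approximate \<open>J\<close> on the
  old vectors.

  The matching of two tuples needs an estimate for all linear combinations at once, and spans are
  unbounded. Errors are therefore measured by the sum of the absolute values of the coefficients:
  such an error amounts to a weight for each vector, and weights are what an amalgam can absorb.

  Profiles use all vectors e and not only unit ones, since homogeneity then determines the norm of e
  + l x for every l, that is, the whole one-point extension. Distances to the sphere alone do not
  determine it, and this is also what separates the two compactifications.\<close>

definition vector_norm :: "('v::real_vector \<Rightarrow> real) \<Rightarrow> bool" where
  "vector_norm q \<longleftrightarrow>
     (\<forall>x. 0 \<le> q x \<and> (q x = 0 \<longleftrightarrow> x = 0)) \<and> (\<forall>a x. q (a *\<^sub>R x) = \<bar>a\<bar> * q x) \<and>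
     (\<forall>x y. q (x + y) \<le> q x + q y)"

lemma vector_normD:
  assumes "vector_norm q"
  shows "0 \<le> q x" "q x = 0 \<longleftrightarrow> x = 0" "q (a *\<^sub>R x) = \<bar>a\<bar> * q x" "q (x + y) \<le> q x + q y"
  using assms unfolding vector_norm_def by blast+

text \<open>Coordinates in a basis of \<open>span C\<close> translate \<open>q\<close> into a norm
  on coordinate sequences, the form in which universality is stated. \<open>J\<close> is controlled
  on \<open>span C\<close> only, so each use has to check that its vectors lie there.\<close>

lemma universal_embedding:
  fixes q :: "'v::real_vector \<Rightarrow> real"
  assumes univ: "universal_for_finite_dimensional TYPE('g::real_normed_vector)"
    and q: "vector_norm q" and C: "finite C"
  obtains J :: "'v \<Rightarrow> 'g::real_normed_vector" where
    "\<And>u v. u \<in> span C \<Longrightarrow> v \<in> span C \<Longrightarrow> J (u + v) = J u + J v"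
    "\<And>a u. u \<in> span C \<Longrightarrow> J (a *\<^sub>R u) = a *\<^sub>R J u"
    "\<And>u. u \<in> span C \<Longrightarrow> norm (J u) = q u"
proof -
  obtain B where B: "B \<subseteq> C" "independent B" "C \<subseteq> span B"
    using maximal_independent_subset by blast
  then have sp: "span C = span B"
    by (metis span_eq span_superset subset_trans)
  have finB: "finite B"
    using B(1) C finite_subset by blast
  obtain b where b: "bij_betw b {0..<card B} B"
    using ex_bij_betw_nat_finite[OF finB] by blast
  define n where "n = card B"
  define L where "L c = (\<Sum>i<n. c i *\<^sub>R b i)" for c :: "nat \<Rightarrow> real"
  define R where "R v i = (if i < n then representation B v (b i) else 0)" for v i
  have b': "bij_betw b {..<n} B"
    using b by (simp add: n_def lessThan_atLeast0)
  have L0: "c = (\<lambda>_. 0)" if "c \<in> fin_vectors n" "L c = 0" for c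
  proof -
    define d where "d v = c (inv_into {..<n} b v)" for v
    have dc: "d (b i) = c i" if "i < n" for i
      using b' that by (simp add: d_def bij_betw_inv_into_left)
    have "L c = (\<Sum>v\<in>B. d v *\<^sub>R v)"
      unfolding L_def sum.reindex_bij_betw[OF b', symmetric] by (rule sum.cong) (auto simp: dc)
    then have "d v = 0" if "v \<in> B" for v
      using independentD[OF B(2) finB order.refl] that \<open>L c = 0\<close> by metis
    then have "c i = 0" if "i < n" for i
      using dc[OF that] b' that by (auto simp: bij_betw_def)
    moreover have "c i = 0" if "\<not> i < n" for i
      using \<open>c \<in> fin_vectors n\<close> that by (simp add: fin_vectors_def)
    ultimately show ?thesis
      by (meson ext)
  qed
  have "norm_on_fin_vectors n (\<lambda>c. q (L c))"
  proof -
    have [simp]: "L (\<lambda>i. c i + d i) = L c + L d" "L (\<lambda>i. a * c i) = a *\<^sub>R L c" "L (\<lambda>_. 0) = 0" for a c d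
      by (simp_all add: L_def scaleR_add_left sum.distrib scaleR_sum_right)
    show ?thesis
      unfolding norm_on_fin_vectors_def
    proof (intro conjI ballI allI)
      show "q (L c) = 0 \<longleftrightarrow> c = (\<lambda>_. 0)" if "c \<in> fin_vectors n" for c
        using vector_normD(2)[OF q] L0[OF that] \<open>L (\<lambda>_. 0) = 0\<close> by metis
    qed (simp_all add: vector_normD(1,3,4)[OF q])
  qed
  then obtain J :: "(nat \<Rightarrow> real) \<Rightarrow> 'g" where J:
      "\<forall>c\<in>fin_vectors n. \<forall>d\<in>fin_vectors n. J (\<lambda>i. c i + d i) = J c + J d"
      "\<forall>a. \<forall>c\<in>fin_vectors n. J (\<lambda>i. a * c i) = a *\<^sub>R J c"
      "\<forall>c\<in>fin_vectors n. norm (J c) = q (L c)"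
    using univ unfolding universal_for_finite_dimensional_def by blast
  have Rf: "R v \<in> fin_vectors n" for v
    by (simp add: R_def fin_vectors_def)
  have LR: "L (R v) = v" if "v \<in> span B" for v
  proof -
    have "L (R v) = (\<Sum>w\<in>B. representation B v w *\<^sub>R w)"
      unfolding L_def sum.reindex_bij_betw[OF b', symmetric] by (rule sum.cong) (auto simp: R_def)
    then show ?thesis
      using sum_representation_eq[OF B(2) that finB order.refl] by simp
  qed
  show ?thesis
  proof (rule that[of "\<lambda>v. J (R v)"]; unfold sp)
    fix u v assume uv: "u \<in> span B" "v \<in> span B"
    have "R (u + v) = (\<lambda>i. R u i + R v i)"
      by (simp add: R_def fun_eq_iff representation_add[OF B(2) uv(2,1)])
    then show "J (R (u + v)) = J (R u) + J (R v)"
      using J(1) Rf by simp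
  next
    fix a u assume u: "u \<in> span B"
    have "R (a *\<^sub>R u) = (\<lambda>i. a * R u i)"
      by (simp add: R_def fun_eq_iff representation_scale[OF B(2) u])
    then show "J (R (a *\<^sub>R u)) = a *\<^sub>R J (R u)"
      using J(2) Rf by simp
  qed (use J(3) Rf LR in auto)
qed

lemma additive_on_span_sum:
  fixes J :: "'v::real_vector \<Rightarrow> 'w::real_vector"
  assumes add: "\<And>u v. u \<in> span C \<Longrightarrow> v \<in> span C \<Longrightarrow> J (u + v) = J u + J v"
    and scale: "\<And>a u. u \<in> span C \<Longrightarrow> J (a *\<^sub>R u) = a *\<^sub>R J u"
    and "finite A" "\<And>a. a \<in> A \<Longrightarrow> f a \<in> span C"
  shows "J (\<Sum>a\<in>A. c a *\<^sub>R f a) = (\<Sum>a\<in>A. c a *\<^sub>R J (f a))"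
  using assms(3,4)
proof (induction A rule: finite_induct)
  case empty
  show ?case
    using scale[OF span_zero, of 0] by simp
next
  case (insert a A)
  then show ?case
    by (simp add: add scale span_scale span_sum)
qed

text \<open>The map \<iota> is meant to be the inclusion of the space as a factor of a product. Then
  \<open>J\<close> after \<iota> is a linear isometry of \<open>span F\<close> into the space, and
  homogeneity applies to it.\<close>

lemma approx_homogeneous_embedding:
  fixes J :: "'v::real_vector \<Rightarrow> 'g::real_normed_vector" and F :: "'g set"
  assumes hom: "approximately_ultrahomogeneous TYPE('g)" and F: "finite F"
    and \<iota>: "linear \<iota>" and C: "\<iota> ` F \<subseteq> span C"
    and J: "\<And>u v. u \<in> span C \<Longrightarrow> v \<in> span C \<Longrightarrow> J (u + v) = J u + J v"
      "\<And>a u. u \<in> span C \<Longrightarrow> J (a *\<^sub>R u) = a *\<^sub>R J u"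
      "\<And>u. \<iota> u \<in> span C \<Longrightarrow> norm (J (\<iota> u)) = norm u"
    and e: "\<epsilon> > 0"
  obtains T where "T \<in> carrier Aut" "\<And>a. a \<in> F \<Longrightarrow> norm (blinfun_apply T a - J (\<iota> a)) < \<epsilon>"
proof -
  have in_C: "\<iota> u \<in> span C" if "u \<in> span F" for u
    using linear_span_image[OF \<iota>, of F] span_mono[OF C] that by (auto simp: span_span)
  have "linear_isometry_on (span F) (\<lambda>u. J (\<iota> u))"
    unfolding linear_isometry_on_def
    using in_C J by (auto simp: linear_add[OF \<iota>] linear_scale[OF \<iota>])
  then have "\<exists>T\<in>carrier Aut. \<forall>x\<in>F. norm (blinfun_apply T x - J (\<iota> x)) < \<epsilon>"
    using hom[unfolded approximately_ultrahomogeneous_def, rule_format, of "span F" "\<lambda>u. J (\<iota> u)" \<epsilon> F]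
      F e span_superset subspace_span by blast
  then show ?thesis
    using that by blast
qed

lemma Aut_inverse_apply:
  fixes T :: "'a::real_normed_vector \<Rightarrow>\<^sub>L 'a"
  assumes "T \<in> carrier Aut"
  obtains S where "S \<in> carrier Aut" "\<And>x. blinfun_apply S (blinfun_apply T x) = x"
    "\<And>x. blinfun_apply T (blinfun_apply S x) = x"
  using Aut_inverse[OF assms] by (metis blinfun_apply_blinfun_compose blinfun_apply_id_blinfun id_apply)

text \<open>\<open>J\<close> embeds the span of F and the new vector \<open>(0, 1)\<close>, and
  \<open>T\<close> carries F close to its image under \<open>J\<close>. The point sought is the
  inverse image of \<open>J (0, 1)\<close> under \<open>T\<close>: only the vectors of F contribute
  to the error, each at most \<eta> times its coefficient, and the norm of the point itself is
  exact.\<close>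

lemma realize_one_point_extension:
  fixes N :: "'g::banach \<times> real \<Rightarrow> real" and F :: "'g set"
  assumes hom: "approximately_ultrahomogeneous TYPE('g)"
    and univ: "universal_for_finite_dimensional TYPE('g)"
    and N: "vector_norm N" and NE: "\<And>e. N (e, 0) = norm e" and F: "finite F" and \<eta>: "\<eta> > 0"
  obtains x where "norm x = N (0, 1)"
    "\<And>c. \<bar>norm (x + (\<Sum>a\<in>F. c a *\<^sub>R a)) - N (\<Sum>a\<in>F. c a *\<^sub>R a, 1)\<bar> \<le> \<eta> * (\<Sum>a\<in>F. \<bar>c a\<bar>)"
proof -
  define C :: "('g \<times> real) set" where "C = insert (0, 1) ((\<lambda>a. (a, 0)) ` F)"
  have "finite C"
    using F by (simp add: C_def)
  then obtain J :: "'g \<times> real \<Rightarrow> 'g" where J: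
    "\<And>u v. u \<in> span C \<Longrightarrow> v \<in> span C \<Longrightarrow> J (u + v) = J u + J v"
    "\<And>a u. u \<in> span C \<Longrightarrow> J (a *\<^sub>R u) = a *\<^sub>R J u"
    "\<And>u. u \<in> span C \<Longrightarrow> norm (J u) = N u"
    using universal_embedding[OF univ N] by metis
  have FC: "(\<lambda>a. (a, 0)) ` F \<subseteq> span C" and C1: "(0, 1) \<in> span C"
    using span_superset[of C] by (auto simp: C_def)
  have lin: "linear (\<lambda>a. (a, 0) :: 'g \<times> real)"
    by (rule linearI) auto
  obtain T where T: "T \<in> carrier Aut"
      "\<And>a. a \<in> F \<Longrightarrow> norm (blinfun_apply T a - J (a, 0)) < \<eta>"
    using approx_homogeneous_embedding[OF hom F lin FC J(1,2) _ \<eta>] J(3) NE by metis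
  obtain S where S: "S \<in> carrier Aut" "\<And>x. blinfun_apply T (blinfun_apply S x) = x"
    using Aut_inverse_apply[OF T(1)] by metis
  show ?thesis
  proof
    show "norm (S (J (0, 1))) = N (0, 1)"
      using S(1) J(3)[OF C1] by (simp add: Aut_iff)
    fix c
    define v where "v = (\<Sum>a\<in>F. c a *\<^sub>R a)"
    have v1: "(v, 1) = (0, 1) + (\<Sum>a\<in>F. c a *\<^sub>R (a, 0::real))"
      by (simp add: v_def prod_eq_iff fst_sum snd_sum)
    have vC: "(\<Sum>a\<in>F. c a *\<^sub>R (a, 0::real)) \<in> span C"
      using FC by (intro span_sum span_scale) auto
    have "J (v, 1) = J (0, 1) + (\<Sum>a\<in>F. c a *\<^sub>R J (a, 0))"
      unfolding v1 J(1)[OF C1 vC]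
      by (subst additive_on_span_sum[where f = "\<lambda>a. (a, 0)", OF J(1,2) F]) (use FC in auto)
    moreover have "T (S (J (0, 1)) + v) = J (0, 1) + (\<Sum>a\<in>F. c a *\<^sub>R T a)"
      by (simp add: S(2) v_def blinfun.add_right blinfun.sum_right blinfun.scaleR_right)
    ultimately have "T (S (J (0, 1)) + v) - J (v, 1) = (\<Sum>a\<in>F. c a *\<^sub>R (T a - J (a, 0)))"
      by (simp add: scaleR_diff_right sum_subtractf)
    moreover have "norm (\<Sum>a\<in>F. c a *\<^sub>R (T a - J (a, 0))) \<le> (\<Sum>a\<in>F. \<bar>c a\<bar> * \<eta>)"
      using T(2) by (intro sum_norm_le) (simp add: less_imp_le mult_left_mono)
    ultimately have "\<bar>norm (T (S (J (0, 1)) + v)) - norm (J (v, 1))\<bar> \<le> \<eta> * (\<Sum>a\<in>F. \<bar>c a\<bar>)"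
      using norm_triangle_ineq3[of "T (S (J (0, 1)) + v)" "J (v, 1)"]
      by (simp add: sum_distrib_left mult.commute)
    moreover have "norm (J (v, 1)) = N (v, 1)"
      using J(3) C1 vC v1 by (metis span_add)
    moreover have "norm (T (S (J (0, 1)) + v)) = norm (S (J (0, 1)) + v)"
      using T(1) by (simp add: Aut_iff)
    ultimately show "\<bar>norm (S (J (0, 1)) + (\<Sum>a\<in>F. c a *\<^sub>R a)) - N (\<Sum>a\<in>F. c a *\<^sub>R a, 1)\<bar>
        \<le> \<eta> * (\<Sum>a\<in>F. \<bar>c a\<bar>)"
      by (simp add: v_def)
  qed
qed

section \<open>Amalgamation of two tuples\<close>

definition amalgam_norm ::
  "'i set \<Rightarrow> ('i \<Rightarrow> real) \<Rightarrow> ('i \<Rightarrow> 'a::real_normed_vector) \<Rightarrow> ('i \<Rightarrow> 'a) \<Rightarrow> 'a \<times> 'a \<Rightarrow> real" where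
  "amalgam_norm I w s t = (\<lambda>(u, v). INF c. norm (u - (\<Sum>i\<in>I. c i *\<^sub>R s i))
     + norm (v + (\<Sum>i\<in>I. c i *\<^sub>R t i)) + (\<Sum>i\<in>I. w i * \<bar>c i\<bar>))"

text \<open>For nonnegative weights this is the largest seminorm on the direct sum of two copies of
  the space that is at most the norm on each copy and at most \<open>w i\<close> at
  \<open>(s i, - t i)\<close>: it glues \<open>s i\<close> to \<open>t i\<close> up to
  \<open>w i\<close>. The hypothesis \<open>close\<close> says that the gluing shortens no vector of
  either copy, and positive weights turn the seminorm into a norm.\<close>

lemma amalgam_norm:
  fixes s t :: "'i \<Rightarrow> 'a::real_normed_vector"
  assumes I: "finite I" and w: "\<And>i. i \<in> I \<Longrightarrow> w i > 0"
    and close: "\<And>c. \<bar>norm (\<Sum>i\<in>I. c i *\<^sub>R s i) - norm (\<Sum>i\<in>I. c i *\<^sub>R t i)\<bar> \<le> (\<Sum>i\<in>I. w i * \<bar>c i\<bar>)"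
  shows "vector_norm (amalgam_norm I w s t)"
    and "amalgam_norm I w s t (u, 0) = norm u"
    and "amalgam_norm I w s t (0, v) = norm v"
    and "i \<in> I \<Longrightarrow> amalgam_norm I w s t (s i, - t i) \<le> w i"
proof -
  define S where "S c = (\<Sum>i\<in>I. c i *\<^sub>R s i)" for c
  define T where "T c = (\<Sum>i\<in>I. c i *\<^sub>R t i)" for c
  define W where "W c = (\<Sum>i\<in>I. w i * \<bar>c i\<bar>)" for c
  define Q where "Q c z = norm (fst z - S c) + norm (snd z + T c) + W c" for c and z :: "'a \<times> 'a"
  define q where "q z = (INF c. Q c z)" for z
  have q_eq: "amalgam_norm I w s t = q"
    by (auto simp: amalgam_norm_def q_def Q_def S_def T_def W_def fun_eq_iff)
  have w0: "0 \<le> w i" if "i \<in> I" for i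
    using w[OF that] by simp
  have W0: "0 \<le> W c" for c
    unfolding W_def using w0 by (simp add: sum_nonneg)
  have Q0: "0 \<le> Q c z" for c z
    using W0 by (simp add: Q_def)
  have qQ: "q z \<le> Q c z" for c z
    unfolding q_def by (rule cINF_lower[OF bdd_belowI[where m = 0]]) (auto simp: Q0)
  have qI: "m \<le> q z" if "\<And>c. m \<le> Q c z" for m z
    unfolding q_def by (rule cINF_greatest) (simp_all add: that)
  have q0: "0 \<le> q z" for z
    by (rule qI) (rule Q0)
  have zero: "S (\<lambda>_. 0) = 0" "T (\<lambda>_. 0) = 0" "W (\<lambda>_. 0) = 0"
    by (simp_all add: S_def T_def W_def)
  have close': "norm (S c) \<le> norm (T c) + W c" "norm (T c) \<le> norm (S c) + W c" for c
    using close[of c] unfolding S_def T_def W_def by linarith+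
  \<comment> \<open>For v = 0 the last two terms cancel, which leaves the lower bound needed on the
    first copy. In the same way \<open>sndle\<close> with u = 0 serves the second copy.\<close>
  have fstle: "norm u \<le> Q c (u, v) - norm (v + T c) + norm (T c)" for u v c
    using norm_triangle_ineq[of "u - S c" "S c"] close'(1)[of c] by (simp add: Q_def)
  have sndle: "norm v \<le> Q c (u, v) - norm (u - S c) + norm (S c)" for u v c
    using norm_triangle_ineq[of "v + T c" "- T c"] close'(2)[of c] by (simp add: Q_def)
  have E1: "q (u, 0) = norm u" for u
  proof (rule antisym)
    show "q (u, 0) \<le> norm u"
      using qQ[of "(u, 0)" "\<lambda>_. 0"] by (simp add: Q_def zero)
    show "norm u \<le> q (u, 0)"
      by (rule qI) (use fstle[of u _ 0] in simp)
  qed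
  have E2: "q (0, v) = norm v" for v
  proof (rule antisym)
    show "q (0, v) \<le> norm v"
      using qQ[of "(0, v)" "\<lambda>_. 0"] by (simp add: Q_def zero)
    show "norm v \<le> q (0, v)"
      by (rule qI) (use sndle[of v _ 0] in simp)
  qed
  \<comment> \<open>Division by \<open>w i\<close> bounds the norm of \<open>S c\<close> by a
    multiple of \<open>W c\<close>. Hence a small value of \<open>q\<close> forces both components
    to be small, and \<open>q\<close> vanishes only at 0.\<close>
  define M where "M = (\<Sum>i\<in>I. norm (s i) / w i)"
  have M0: "0 \<le> M"
    unfolding M_def using w0 by (simp add: sum_nonneg)
  have SM: "norm (S c) \<le> M * W c" for c
  proof -
    have "norm (S c) \<le> (\<Sum>i\<in>I. norm (s i) / w i * (w i * \<bar>c i\<bar>))"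
      unfolding S_def using w by (intro sum_norm_le) (auto simp: less_imp_neq[THEN not_sym])
    also have "\<dots> \<le> (\<Sum>i\<in>I. norm (s i) / w i * W c)"
    proof (intro sum_mono mult_left_mono)
      fix i assume "i \<in> I"
      then show "w i * \<bar>c i\<bar> \<le> W c" "0 \<le> norm (s i) / w i"
        unfolding W_def using I w0 by (auto intro!: member_le_sum)
    qed
    finally show ?thesis
      by (simp add: M_def sum_distrib_right)
  qed
  have bound: "norm u \<le> (1 + M) * q (u, v)" "norm v \<le> (2 + M) * q (u, v)" for u v
  proof -
    have "W c \<le> Q c (u, v)" for c
      by (simp add: Q_def)
    then have MW: "M * W c \<le> M * Q c (u, v)" for c
      using M0 by (rule mult_left_mono)
    have "norm u / (1 + M) \<le> q (u, v)"
    proof (rule qI)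
      fix c
      have "norm u \<le> norm (u - S c) + M * W c"
        using norm_triangle_ineq[of "u - S c" "S c"] SM[of c] by simp
      also have "\<dots> \<le> Q c (u, v) + M * Q c (u, v)"
        using MW[of c] W0[of c] norm_ge_zero[of "v + T c"] unfolding Q_def fst_conv snd_conv by linarith
      finally show "norm u / (1 + M) \<le> Q c (u, v)"
        using M0 by (simp add: divide_le_eq algebra_simps)
    qed
    then show "norm u \<le> (1 + M) * q (u, v)"
      using M0 by (simp add: divide_le_eq mult.commute)
    have "norm v / (2 + M) \<le> q (u, v)"
    proof (rule qI)
      fix c
      have "norm v \<le> Q c (u, v) + M * W c"
        using sndle[of v c u] SM[of c] norm_ge_zero[of "u - S c"] by linarith
      then show "norm v / (2 + M) \<le> Q c (u, v)"
        using M0 MW[of c] Q0[of c "(u, v)"] by (simp add: divide_le_eq algebra_simps)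
    qed
    then show "norm v \<le> (2 + M) * q (u, v)"
      using M0 by (simp add: divide_le_eq mult.commute)
  qed
  have q00: "q 0 = 0"
    using E1[of 0] by (simp add: zero_prod_def)
  have scale_le: "q (a *\<^sub>R z) \<le> \<bar>a\<bar> * q z" if "a \<noteq> 0" for a z
  proof -
    have "q (a *\<^sub>R z) / \<bar>a\<bar> \<le> q z"
    proof (rule qI)
      fix c
      have "S (\<lambda>i. a * c i) = a *\<^sub>R S c" "T (\<lambda>i. a * c i) = a *\<^sub>R T c" "W (\<lambda>i. a * c i) = \<bar>a\<bar> * W c"
        by (simp_all add: S_def T_def W_def scaleR_sum_right sum_distrib_left abs_mult mult.left_commute)
      then have "Q (\<lambda>i. a * c i) (a *\<^sub>R z) = \<bar>a\<bar> * Q c z"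
        by (simp add: Q_def distrib_left flip: scaleR_diff_right scaleR_add_right)
      then show "q (a *\<^sub>R z) / \<bar>a\<bar> \<le> Q c z"
        using qQ[of "a *\<^sub>R z" "\<lambda>i. a * c i"] that by (simp add: divide_le_eq mult.commute)
    qed
    then show ?thesis
      using that by (simp add: divide_le_eq mult.commute)
  qed
  have scale: "q (a *\<^sub>R z) = \<bar>a\<bar> * q z" for a z
  proof (cases "a = 0")
    case False
    have "\<bar>a\<bar> * q z \<le> q (a *\<^sub>R z)"
      using scale_le[of "inverse a" "a *\<^sub>R z"] False by (simp add: field_simps)
    then show ?thesis
      using scale_le[OF False, of z] by simp
  qed (simp add: q00)
  have add: "q (y + z) \<le> q y + q z" for y z
  proof -
    have yz: "q (y + z) \<le> Q c y + Q d z" for c d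
    proof -
      have ST: "S (\<lambda>i. c i + d i) = S c + S d" "T (\<lambda>i. c i + d i) = T c + T d"
        by (simp_all add: S_def T_def scaleR_add_left sum.distrib)
      have "W (\<lambda>i. c i + d i) \<le> W c + W d"
        unfolding W_def sum.distrib[symmetric] using w
        by (intro sum_mono) (metis abs_triangle_ineq distrib_left less_imp_le mult_left_mono)
      then have "Q (\<lambda>i. c i + d i) (y + z) \<le> Q c y + Q d z"
        using norm_triangle_ineq[of "fst y - S c" "fst z - S d"]
          norm_triangle_ineq[of "snd y + T c" "snd z + T d"]
        by (simp add: Q_def ST algebra_simps)
      then show ?thesis
        using qQ order_trans by blast
    qed
    have z: "q (y + z) - Q c y \<le> q z" for c
    proof (rule qI)
      show "q (y + z) - Q c y \<le> Q d z" for d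
        using yz[of c d] by linarith
    qed
    have "q (y + z) - q z \<le> q y"
    proof (rule qI)
      show "q (y + z) - q z \<le> Q c y" for c
        using z[of c] by linarith
    qed
    then show ?thesis
      by simp
  qed
  have "z = 0" if "q z = 0" for z
  proof -
    have "norm (fst z) \<le> 0" "norm (snd z) \<le> 0"
      using bound[where u = "fst z" and v = "snd z", unfolded prod.collapse that] by simp_all
    then show ?thesis
      by (simp add: prod_eq_iff)
  qed
  then show "vector_norm (amalgam_norm I w s t)"
    unfolding q_eq vector_norm_def using q0 q00 scale add by blast
  show "amalgam_norm I w s t (u, 0) = norm u" "amalgam_norm I w s t (0, v) = norm v"
    unfolding q_eq by (rule E1 E2)+
  show "amalgam_norm I w s t (s i, - t i) \<le> w i" if "i \<in> I"
  proof -
    \<comment> \<open>With the single coefficient 1 at i both norms in the infimum vanish and only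
      \<open>w i\<close> remains.\<close>
    have "S (\<lambda>j. if j = i then 1 else 0) = s i" "T (\<lambda>j. if j = i then 1 else 0) = t i"
      "W (\<lambda>j. if j = i then 1 else 0) = w i"
      using that I by (simp_all add: S_def T_def W_def if_distrib[of "\<lambda>x. x *\<^sub>R _"]
          if_distrib[of abs] if_distrib[of "\<lambda>x. _ * x"] cong: if_cong)
    then show ?thesis
      unfolding q_eq using qQ[of "(s i, - t i)" "\<lambda>j. if j = i then 1 else 0"] by (simp add: Q_def)
  qed
qed

text \<open>The tuples need not span isometric subspaces, so homogeneity cannot be applied to them
  directly. In the amalgam \<open>(s i, 0)\<close> and \<open>(0, t i)\<close> are at distance at
  most \<open>w i\<close>. Automorphisms \<open>A\<close> and \<open>B\<close> bring the two tuples
  next to their images under \<open>J\<close>, and the automorphism sought is \<open>A\<close>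
  followed by the inverse of \<open>B\<close>.\<close>

lemma automorphism_matching_tuples:
  fixes s t :: "'i \<Rightarrow> 'g::banach"
  assumes hom: "approximately_ultrahomogeneous TYPE('g)"
    and univ: "universal_for_finite_dimensional TYPE('g)"
    and I: "finite I" and w: "\<And>i. i \<in> I \<Longrightarrow> w i > 0" and \<epsilon>: "\<epsilon> > 0"
    and close: "\<And>c. \<bar>norm (\<Sum>i\<in>I. c i *\<^sub>R s i) - norm (\<Sum>i\<in>I. c i *\<^sub>R t i)\<bar> \<le> (\<Sum>i\<in>I. w i * \<bar>c i\<bar>)"
  obtains g where "g \<in> carrier Aut" "\<And>i. i \<in> I \<Longrightarrow> norm (blinfun_apply g (s i) - t i) < w i + \<epsilon>"
proof -
  define q where "q = amalgam_norm I w s t"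
  have q: "vector_norm q" "\<And>u. q (u, 0) = norm u" "\<And>v. q (0, v) = norm v"
      "\<And>i. i \<in> I \<Longrightarrow> q (s i, - t i) \<le> w i"
    unfolding q_def by (rule amalgam_norm[OF I w close]; assumption)+
  define C where "C = (\<lambda>i. (s i, 0)) ` I \<union> (\<lambda>i. (0, t i)) ` I"
  have "finite C"
    using I by (simp add: C_def)
  then obtain J :: "'g \<times> 'g \<Rightarrow> 'g" where J:
    "\<And>u v. u \<in> span C \<Longrightarrow> v \<in> span C \<Longrightarrow> J (u + v) = J u + J v"
    "\<And>a u. u \<in> span C \<Longrightarrow> J (a *\<^sub>R u) = a *\<^sub>R J u"
    "\<And>u. u \<in> span C \<Longrightarrow> norm (J u) = q u"
    using universal_embedding[OF univ q(1)] by metis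
  have sC: "(s i, 0) \<in> span C" and tC: "(0, t i) \<in> span C" if "i \<in> I" for i
    using span_superset[of C] that by (auto simp: C_def)
  have e2: "\<epsilon> / 2 > 0" using \<epsilon> by simp
  have lin: "linear (\<lambda>a. (a, 0) :: 'g \<times> 'g)" "linear (\<lambda>a. (0, a) :: 'g \<times> 'g)"
    by (rule linearI; auto)+
  obtain A where A: "A \<in> carrier Aut"
      "\<And>a. a \<in> s ` I \<Longrightarrow> norm (blinfun_apply A a - J (a, 0)) < \<epsilon> / 2"
    using approx_homogeneous_embedding[OF hom _ lin(1) _ J(1,2) _ e2, of "s ` I"] J(3) q(2) I sC
    by (smt (verit, best) finite_imageI image_iff image_subset_iff)
  obtain B where B: "B \<in> carrier Aut"
      "\<And>a. a \<in> t ` I \<Longrightarrow> norm (blinfun_apply B a - J (0, a)) < \<epsilon> / 2"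
    using approx_homogeneous_embedding[OF hom _ lin(2) _ J(1,2) _ e2, of "t ` I"] J(3) q(3) I tC
    by (smt (verit, best) finite_imageI image_iff image_subset_iff)
  obtain B' where B': "B' \<in> carrier Aut" "\<And>x. blinfun_apply B (blinfun_apply B' x) = x"
    using Aut_inverse_apply[OF B(1)] by metis
  show ?thesis
  proof
    interpret group "Aut :: ('g \<Rightarrow>\<^sub>L 'g) monoid"
      by (rule group_Aut)
    show "B' o\<^sub>L A \<in> carrier Aut"
      using m_closed[OF B'(1) A(1)] by (simp add: Aut_def)
    fix i assume i: "i \<in> I"
    have "norm ((B' o\<^sub>L A) (s i) - t i) = norm (B ((B' o\<^sub>L A) (s i) - t i))"
      using B(1) by (simp add: Aut_iff)
    also have "\<dots> = norm (A (s i) - B (t i))"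
      by (simp add: blinfun.diff_right B'(2))
    also have "\<dots> \<le> norm (A (s i) - J (s i, 0)) + norm (J (s i, 0) - J (0, t i)) + norm (B (t i) - J (0, t i))"
      by norm
    also have "norm (J (s i, 0) - J (0, t i)) \<le> w i"
    proof -
      have "J (s i, - t i) = J (s i, 0) - J (0, t i)"
        using J(1)[OF sC[OF i] span_scale[OF tC[OF i], of "-1"]] J(2)[OF tC[OF i], of "-1"] by simp
      moreover have "(s i, - t i) \<in> span C"
        using span_add[OF sC[OF i] span_scale[OF tC[OF i], of "-1"]] by simp
      ultimately show ?thesis
        using J(3)[of "(s i, - t i)"] q(4)[OF i] by simp
    qed
    finally show "norm ((B' o\<^sub>L A) (s i) - t i) < w i + \<epsilon>"
      using A(2)[of "s i"] B(2)[of "t i"] i by simp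
  qed
qed

section \<open>Profiles\<close>

text \<open>With \<open>x + e\<close> in place of \<open>x - e\<close> the profile is the
  restriction to l = 1 of the seminorm sending (e, l) to the norm of e + l x.\<close>

definition distance_profile :: "'a::real_normed_vector \<Rightarrow> 'a \<Rightarrow> real" where
  "distance_profile x = (\<lambda>e. norm (x + e))"

definition profiles :: "('a::real_normed_vector \<Rightarrow> real) set" where
  "profiles = closure (distance_profile ` unit_sphere)"

text \<open>The device for passing to limits: a relation between finitely many values of a profile
  is checked at points of the sphere, up to \<epsilon>.\<close>

lemma profile_approx:
  assumes "p \<in> profiles" "finite F" "\<epsilon> > 0"
  shows "\<exists>x. norm x = 1 \<and> (\<forall>e\<in>F. \<bar>p e - norm (x + e)\<bar> < \<epsilon>)"
proof -
  have "open {q. \<forall>e\<in>F. q e \<in> ball (p e) \<epsilon>}"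
    using product_topology_basis'[of F "\<lambda>e. ball (p e) \<epsilon>" "\<lambda>e. e"] assms(2) by simp
  moreover have "p \<in> {q. \<forall>e\<in>F. q e \<in> ball (p e) \<epsilon>}"
    using assms(3) by simp
  ultimately have "distance_profile ` unit_sphere \<inter> {q. \<forall>e\<in>F. q e \<in> ball (p e) \<epsilon>} \<noteq> {}"
    using assms(1) unfolding profiles_def closure_iff_nhds_not_empty by blast
  then show ?thesis
    by (auto simp: distance_profile_def dist_real_def)
qed

lemma profile_lipschitz:
  assumes "p \<in> profiles"
  shows "\<bar>p e - p f\<bar> \<le> norm (e - f)"
proof (rule field_le_epsilon)
  fix \<epsilon> :: real assume "\<epsilon> > 0"
  then obtain x where "\<bar>p e - norm (x + e)\<bar> < \<epsilon> / 2" "\<bar>p f - norm (x + f)\<bar> < \<epsilon> / 2"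
    using profile_approx[OF assms, of "{e, f}" "\<epsilon> / 2"] by auto
  moreover have "\<bar>norm (x + e) - norm (x + f)\<bar> \<le> norm (e - f)"
    using norm_triangle_ineq3[of "x + e" "x + f"] by simp
  ultimately show "\<bar>p e - p f\<bar> \<le> norm (e - f) + \<epsilon>"
    by linarith
qed

lemma profile_near_norm:
  assumes "p \<in> profiles"
  shows "\<bar>p e - norm e\<bar> \<le> 1"
proof (rule field_le_epsilon)
  fix \<epsilon> :: real assume "\<epsilon> > 0"
  then obtain x where "norm x = 1" "\<bar>p e - norm (x + e)\<bar> < \<epsilon>"
    using profile_approx[OF assms, of "{e}" \<epsilon>] by auto
  moreover have "\<bar>norm (x + e) - norm e\<bar> \<le> norm x"
    using norm_triangle_ineq3[of "x + e" e] by simp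
  ultimately show "\<bar>p e - norm e\<bar> \<le> 1 + \<epsilon>"
    by linarith
qed

lemma profile_0:
  assumes "p \<in> profiles"
  shows "p 0 = 1"
proof -
  have "\<bar>p 0 - 1\<bar> \<le> 0 + \<epsilon>" if "\<epsilon> > 0" for \<epsilon>
    using profile_approx[OF assms, of "{0}" \<epsilon>] that by auto
  then show ?thesis
    using field_le_epsilon[of "\<bar>p 0 - 1\<bar>" 0] by simp
qed

text \<open>The homogeneous extension of p from height 1. For the profile of x it is the norm of e +
  l x, and it vanishes at \<open>(- x, 1)\<close>; so in general it is only a seminorm.\<close>

definition profile_seminorm :: "('a::real_normed_vector \<Rightarrow> real) \<Rightarrow> 'a \<times> real \<Rightarrow> real" where
  "profile_seminorm p = (\<lambda>(e, l). if l = 0 then norm e else \<bar>l\<bar> * p (inverse l *\<^sub>R e))"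

lemma profile_seminorm_approx:
  assumes p: "p \<in> profiles" and Z: "finite Z" and \<epsilon>: "\<epsilon> > 0"
  shows "\<exists>x. norm x = 1 \<and> (\<forall>z\<in>Z. \<bar>profile_seminorm p z - norm (fst z + snd z *\<^sub>R x)\<bar> < \<epsilon>)"
proof -
  \<comment> \<open>The error at z is multiplied by \<open>\<bar>snd z\<bar>\<close>, so the profile
    is approximated up to \<open>\<epsilon> / M\<close>. The summand 1 makes M positive and strictly
    larger than each factor.\<close>
  define M where "M = 1 + (\<Sum>z\<in>Z. \<bar>snd z\<bar>)"
  have M: "M > 0"
    by (simp add: M_def sum_nonneg add_pos_nonneg)
  obtain x where x: "norm x = 1"
      "\<And>z. z \<in> Z \<Longrightarrow> \<bar>p (inverse (snd z) *\<^sub>R fst z) - norm (x + inverse (snd z) *\<^sub>R fst z)\<bar> < \<epsilon> / M"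
    using profile_approx[OF p, of "(\<lambda>z. inverse (snd z) *\<^sub>R fst z) ` Z" "\<epsilon> / M"] Z \<epsilon> M by auto
  show ?thesis
  proof (intro exI[of _ x] conjI ballI)
    fix z assume z: "z \<in> Z"
    show "\<bar>profile_seminorm p z - norm (fst z + snd z *\<^sub>R x)\<bar> < \<epsilon>"
    proof (cases "snd z = 0")
      case True
      then show ?thesis
        using \<epsilon> by (cases z) (simp add: profile_seminorm_def)
    next
      case False
      let ?e = "inverse (snd z) *\<^sub>R fst z"
      have "fst z + snd z *\<^sub>R x = snd z *\<^sub>R (x + ?e)"
        using False by (simp add: scaleR_add_right)
      then have n: "norm (fst z + snd z *\<^sub>R x) = \<bar>snd z\<bar> * norm (x + ?e)"
        by (metis norm_scaleR)
      have "\<bar>snd z\<bar> \<le> (\<Sum>z\<in>Z. \<bar>snd z\<bar>)"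
        using Z z by (intro member_le_sum) auto
      then have "\<bar>snd z\<bar> < M"
        by (simp add: M_def)
      then have "\<bar>snd z\<bar> * \<bar>p ?e - norm (x + ?e)\<bar> < M * (\<epsilon> / M)"
        using x(2)[OF z] False by (intro mult_strict_mono) auto
      moreover have "profile_seminorm p z - norm (fst z + snd z *\<^sub>R x) = \<bar>snd z\<bar> * (p ?e - norm (x + ?e))"
        using False n by (cases z) (simp add: profile_seminorm_def right_diff_distrib)
      ultimately show ?thesis
        using M by (simp add: abs_mult)
    qed
  qed (rule x(1))
qed

text \<open>Homogeneity can be read off the formula. Nonnegativity and the triangle inequality are
  inherited from the seminorms of points x of the sphere, approximated at the one or three vectors
  involved.\<close>

lemma profile_seminorm:
  assumes p: "p \<in> profiles"
  shows "0 \<le> profile_seminorm p z"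
    and "profile_seminorm p (a *\<^sub>R z) = \<bar>a\<bar> * profile_seminorm p z"
    and "profile_seminorm p (y + z) \<le> profile_seminorm p y + profile_seminorm p z"
    and "profile_seminorm p (e, 0) = norm e"
    and "profile_seminorm p (e, 1) = p e"
proof -
  show "0 \<le> profile_seminorm p z"
  proof (rule field_le_epsilon)
    fix \<epsilon> :: real assume "\<epsilon> > 0"
    then obtain x where "\<bar>profile_seminorm p z - norm (fst z + snd z *\<^sub>R x)\<bar> < \<epsilon>"
      using profile_seminorm_approx[OF p, of "{z}" \<epsilon>] by auto
    then show "0 \<le> profile_seminorm p z + \<epsilon>"
      using norm_ge_zero[of "fst z + snd z *\<^sub>R x"] by linarith
  qed
  show "profile_seminorm p (a *\<^sub>R z) = \<bar>a\<bar> * profile_seminorm p z"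
  proof (cases "a = 0")
    case False
    have "inverse (a * l) *\<^sub>R a *\<^sub>R e = inverse l *\<^sub>R e" for e :: 'a and l
      using False by simp
    then show ?thesis
      using False by (cases z) (simp add: profile_seminorm_def abs_mult del: scaleR_scaleR inverse_mult_distrib)
  qed (cases z, simp add: profile_seminorm_def)
  show "profile_seminorm p (y + z) \<le> profile_seminorm p y + profile_seminorm p z"
  proof (rule field_le_epsilon)
    fix \<epsilon> :: real assume "\<epsilon> > 0"
    then obtain x where x: "\<And>w. w \<in> {y, z, y + z} \<Longrightarrow>
        \<bar>profile_seminorm p w - norm (fst w + snd w *\<^sub>R x)\<bar> < \<epsilon> / 3"
      using profile_seminorm_approx[OF p, of "{y, z, y + z}" "\<epsilon> / 3"] by (metis finite.emptyI finite.insertI zero_less_divide_iff zero_less_numeral)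
    have "norm (fst (y + z) + snd (y + z) *\<^sub>R x) \<le> norm (fst y + snd y *\<^sub>R x) + norm (fst z + snd z *\<^sub>R x)"
      using norm_triangle_ineq[of "fst y + snd y *\<^sub>R x" "fst z + snd z *\<^sub>R x"]
      by (simp add: algebra_simps)
    moreover have "\<bar>profile_seminorm p y - norm (fst y + snd y *\<^sub>R x)\<bar> < \<epsilon> / 3"
      "\<bar>profile_seminorm p z - norm (fst z + snd z *\<^sub>R x)\<bar> < \<epsilon> / 3"
      "\<bar>profile_seminorm p (y + z) - norm (fst (y + z) + snd (y + z) *\<^sub>R x)\<bar> < \<epsilon> / 3"
      using x by blast+
    ultimately show "profile_seminorm p (y + z) \<le> profile_seminorm p y + profile_seminorm p z + \<epsilon>"
      by linarith
  qed
qed (simp_all add: profile_seminorm_def)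

text \<open>The seminorm \<open>P\<close> of the profile may be degenerate, so a small multiple of
  the sum norm \<open>L\<close> is mixed in. Both agree on \<open>(e, 0)\<close> and at
  \<open>(0, 1)\<close>, hence the mixture still extends the norm and gives the new vector norm 1,
  and its deviation from \<open>P\<close> at \<open>(v, 1)\<close> is proportional to the norm of
  v.\<close>

lemma realize_profile:
  fixes p :: "'g::banach \<Rightarrow> real"
  assumes hom: "approximately_ultrahomogeneous TYPE('g)"
    and univ: "universal_for_finite_dimensional TYPE('g)"
    and p: "p \<in> profiles" and F: "finite F" and \<eta>: "\<eta> > 0"
  obtains x where "norm x = 1"
    "\<And>c. \<bar>norm (x + (\<Sum>a\<in>F. c a *\<^sub>R a)) - p (\<Sum>a\<in>F. c a *\<^sub>R a)\<bar> \<le> \<eta> * (\<Sum>a\<in>F. \<bar>c a\<bar>)"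
proof -
  define A where "A = (\<Sum>a\<in>F. norm a)"
  have A: "0 \<le> A"
    by (simp add: A_def sum_nonneg)
  \<comment> \<open>The mixing error at v is at most \<open>2 * \<theta> * norm v\<close>, hence at
    most \<open>2 * \<theta> * A\<close> times the sum of the coefficients in absolute value. The
    choice gives \<open>\<theta> * A \<le> \<eta> / 4\<close>, which uses one half of \<eta>; the
    other half is left for the realization in the space.\<close>
  define \<theta> where "\<theta> = min 1 (\<eta> / (4 * (A + 1)))"
  have \<theta>: "0 < \<theta>" "\<theta> \<le> 1"
    using A \<eta> by (simp_all add: \<theta>_def)
  have "\<theta> * A \<le> \<eta> / (4 * (A + 1)) * (A + 1)"
    using A \<eta> by (intro mult_mono) (simp_all add: \<theta>_def)
  also have "\<dots> = \<eta> / 4"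
    using A by (simp add: divide_simps)
  finally have \<theta>A: "\<theta> * A \<le> \<eta> / 4" .
  define P where "P = profile_seminorm p"
  note P = profile_seminorm[OF p, folded P_def]
  define L where "L = (\<lambda>z :: 'g \<times> real. norm (fst z) + \<bar>snd z\<bar>)"
  have L: "0 \<le> L z" "L (a *\<^sub>R z) = \<bar>a\<bar> * L z" "L (y + z) \<le> L y + L z" "L z = 0 \<Longrightarrow> z = 0" for a y z
    using norm_triangle_ineq[of "fst y" "fst z"] by (auto simp: L_def abs_mult distrib_left prod_eq_iff add_nonneg_eq_0_iff)
  define N where "N z = (1 - \<theta>) * P z + \<theta> * L z" for z
  have N: "vector_norm N"
    unfolding vector_norm_def
  proof (intro conjI allI)
    show "0 \<le> N z" for z
      using \<theta> P(1) L(1) by (simp add: N_def)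
    show "N (a *\<^sub>R z) = \<bar>a\<bar> * N z" for a z
      by (simp add: N_def P(2) L(2) algebra_simps)
    show "N (y + z) \<le> N y + N z" for y z
      using mult_left_mono[OF P(3)[of y z], of "1 - \<theta>"] mult_left_mono[OF L(3)[of y z], of \<theta>] \<theta>
      by (simp add: N_def algebra_simps)
    show "N z = 0 \<longleftrightarrow> z = 0" for z
    proof
      assume "N z = 0"
      moreover have "0 \<le> (1 - \<theta>) * P z" "0 \<le> \<theta> * L z"
        using \<theta> P(1) L(1) by simp_all
      ultimately have "\<theta> * L z = 0"
        unfolding N_def by linarith
      then show "z = 0"
        using \<theta> L(4) by simp
    qed (use P(4)[of 0] in \<open>simp add: N_def L_def zero_prod_def\<close>)
  qed
  have NE: "N (e, 0) = norm e" for e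
    by (simp add: N_def P(4) L_def algebra_simps)
  have \<eta>2: "\<eta> / 2 > 0"
    using \<eta> by simp
  obtain x where x: "norm x = N (0, 1)"
    "\<And>c. \<bar>norm (x + (\<Sum>a\<in>F. c a *\<^sub>R a)) - N (\<Sum>a\<in>F. c a *\<^sub>R a, 1)\<bar> \<le> \<eta> / 2 * (\<Sum>a\<in>F. \<bar>c a\<bar>)"
    using realize_one_point_extension[OF hom univ N NE F \<eta>2] by blast
  show ?thesis
  proof
    show "norm x = 1"
      by (simp add: x(1) N_def P(5) profile_0[OF p] L_def)
    fix c
    define v where "v = (\<Sum>a\<in>F. c a *\<^sub>R a)"
    have "norm v \<le> (\<Sum>a\<in>F. \<bar>c a\<bar> * norm a)"
      unfolding v_def by (intro sum_norm_le) simp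
    also have "\<dots> \<le> (\<Sum>a\<in>F. \<bar>c a\<bar> * A)"
      unfolding A_def using F by (intro sum_mono mult_left_mono member_le_sum) auto
    finally have v: "norm v \<le> A * (\<Sum>a\<in>F. \<bar>c a\<bar>)"
      by (simp add: sum_distrib_left mult.commute)
    have "\<bar>p v - p 0\<bar> \<le> norm v"
      using profile_lipschitz[OF p, of v 0] by simp
    then have "\<bar>norm v + 1 - p v\<bar> \<le> 2 * norm v"
      using profile_0[OF p] by linarith
    moreover have "N (v, 1) - p v = \<theta> * (norm v + 1 - p v)"
      by (simp add: N_def P(5) L_def algebra_simps)
    ultimately have "\<bar>N (v, 1) - p v\<bar> \<le> \<theta> * (2 * norm v)"
      using \<theta> by (simp add: abs_mult)
    also have "\<dots> \<le> \<theta> * (2 * (A * (\<Sum>a\<in>F. \<bar>c a\<bar>)))"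
      using \<theta> v by simp
    also have "\<dots> = 2 * ((\<theta> * A) * (\<Sum>a\<in>F. \<bar>c a\<bar>))"
      by simp
    also have "\<dots> \<le> 2 * (\<eta> / 4 * (\<Sum>a\<in>F. \<bar>c a\<bar>))"
      using \<theta>A by (intro mult_left_mono mult_right_mono) (auto simp: sum_nonneg)
    finally have "\<bar>N (v, 1) - p v\<bar> \<le> \<eta> / 2 * (\<Sum>a\<in>F. \<bar>c a\<bar>)"
      by simp
    then show "\<bar>norm (x + (\<Sum>a\<in>F. c a *\<^sub>R a)) - p (\<Sum>a\<in>F. c a *\<^sub>R a)\<bar> \<le> \<eta> * (\<Sum>a\<in>F. \<bar>c a\<bar>)"
      using x(2)[of c] unfolding v_def by linarith
  qed
qed

section \<open>Moving points of the sphere with nearly the same profile\<close>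

lemma compact_bounded_combinations:
  fixes F :: "'a::real_normed_vector set"
  assumes "finite F"
  shows "compact {\<Sum>a\<in>F. c a *\<^sub>R a |c. \<forall>a\<in>F. \<bar>c a\<bar> \<le> R}"
  using assms
proof (induction F rule: finite_induct)
  case empty
  then show ?case by simp
next
  case (insert b F)
  have "compact ((\<lambda>r. r *\<^sub>R b) ` {-R..R})"
    by (intro compact_continuous_image continuous_intros) simp
  then have "compact {x + y |x y. x \<in> (\<lambda>r. r *\<^sub>R b) ` {-R..R} \<and>
      y \<in> {\<Sum>a\<in>F. c a *\<^sub>R a |c. \<forall>a\<in>F. \<bar>c a\<bar> \<le> R}}"
    using insert.IH by (rule compact_sums)
  also have "{x + y |x y. x \<in> (\<lambda>r. r *\<^sub>R b) ` {-R..R} \<and>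
      y \<in> {\<Sum>a\<in>F. c a *\<^sub>R a |c. \<forall>a\<in>F. \<bar>c a\<bar> \<le> R}}
    = {\<Sum>a\<in>insert b F. c a *\<^sub>R a |c. \<forall>a\<in>insert b F. \<bar>c a\<bar> \<le> R}" (is "?L = ?R")
  proof (intro equalityI subsetI)
    fix z assume "z \<in> ?L"
    then obtain r c where z: "z = r *\<^sub>R b + (\<Sum>a\<in>F. c a *\<^sub>R a)" "\<bar>r\<bar> \<le> R" "\<forall>a\<in>F. \<bar>c a\<bar> \<le> R"
      by (auto simp: abs_le_iff)
    moreover have "(\<Sum>a\<in>F. (c(b := r)) a *\<^sub>R a) = (\<Sum>a\<in>F. c a *\<^sub>R a)"
      using insert.hyps by (intro sum.cong) auto
    ultimately have "z = (\<Sum>a\<in>insert b F. (c(b := r)) a *\<^sub>R a)" "\<forall>a\<in>insert b F. \<bar>(c(b := r)) a\<bar> \<le> R"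
      using insert.hyps by auto
    then show "z \<in> ?R"
      by blast
  next
    fix z assume "z \<in> ?R"
    then obtain c where "z = c b *\<^sub>R b + (\<Sum>a\<in>F. c a *\<^sub>R a)" "\<bar>c b\<bar> \<le> R" "\<forall>a\<in>F. \<bar>c a\<bar> \<le> R"
      using insert.hyps by auto
    then show "z \<in> ?L"
      by (fastforce simp: abs_le_iff)
  qed
  finally show ?case .
qed


text \<open>The automorphisms are obtained by matching the tuple of \<open>F\<close> and \<open>x'\<close> with that of \<open>F\<close> and \<open>x\<close>.
  Only the combinations \<open>x' + e\<close> with \<open>e\<close> in a bounded part of \<open>span F\<close> have to be controlled:
  far away, the error allowed on \<open>F\<close> exceeds the difference, which is at most 2.\<close>

lemma automorphism_near_profile:
  fixes p :: "'g::banach \<Rightarrow> real"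
  assumes hom: "approximately_ultrahomogeneous TYPE('g)"
    and univ: "universal_for_finite_dimensional TYPE('g)"
    and p: "p \<in> profiles" and F: "finite F" and \<delta>: "\<delta> > 0"
    and x: "norm x = 1"
      "\<And>c. \<bar>norm (x + (\<Sum>a\<in>F. c a *\<^sub>R a)) - p (\<Sum>a\<in>F. c a *\<^sub>R a)\<bar> \<le> \<delta> / 4 * (\<Sum>a\<in>F. \<bar>c a\<bar>)"
    and \<eta>: "\<eta> > 0"
  obtains M \<kappa> where "finite M" "\<kappa> > 0"
    "\<And>x'. norm x' = 1 \<Longrightarrow> (\<And>m. m \<in> M \<Longrightarrow> \<bar>norm (x' + m) - p m\<bar> < \<kappa>) \<Longrightarrow>
      \<exists>g\<in>carrier Aut. (\<forall>a\<in>F. norm (blinfun_apply g a - a) < \<delta>) \<and> norm (blinfun_apply g x' - x) < \<eta>"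
proof -
  \<comment> \<open>A coefficient beyond \<open>8 / \<delta>\<close> makes
    \<open>\<delta> / 4\<close> times the sum of the coefficients at least 2, which already covers
    any difference.\<close>
  define D where "D = {\<Sum>a\<in>F. c a *\<^sub>R a |c. \<forall>a\<in>F. \<bar>c a\<bar> \<le> 8 / \<delta>}"
  have "compact D"
    unfolding D_def by (rule compact_bounded_combinations[OF F])
  \<comment> \<open>With tolerance \<open>\<eta> / 4\<close> on this net, and
    \<open>\<eta> / 8\<close> lost twice in passing from v to the nearest m, the difference on D
    stays below \<open>\<eta> / 2\<close>.\<close>
  then obtain M where M: "finite M" "D \<subseteq> (\<Union>m\<in>M. ball m (\<eta> / 8))"
    using \<eta> unfolding compact_eq_totally_bounded by (meson zero_less_divide_iff zero_less_numeral)
  show ?thesis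
  proof
    fix x' assume x': "norm x' = 1" "\<And>m. m \<in> M \<Longrightarrow> \<bar>norm (x' + m) - p m\<bar> < \<eta> / 4"
    have near: "\<bar>norm (x' + (\<Sum>a\<in>F. c a *\<^sub>R a)) - p (\<Sum>a\<in>F. c a *\<^sub>R a)\<bar> \<le> \<eta> / 2 + \<delta> / 4 * (\<Sum>a\<in>F. \<bar>c a\<bar>)"
      for c
    proof -
      define v where "v = (\<Sum>a\<in>F. c a *\<^sub>R a)"
      have s0: "0 \<le> \<delta> / 4 * (\<Sum>a\<in>F. \<bar>c a\<bar>)"
        using \<delta> by (simp add: sum_nonneg)
      have "\<bar>norm (x' + v) - p v\<bar> \<le> \<eta> / 2 + \<delta> / 4 * (\<Sum>a\<in>F. \<bar>c a\<bar>)"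
      proof (cases "\<forall>a\<in>F. \<bar>c a\<bar> \<le> 8 / \<delta>")
        case True
        then have "v \<in> D"
          by (auto simp: D_def v_def)
        then obtain m where m: "m \<in> M" "norm (v - m) < \<eta> / 8"
          using M(2) by (auto simp: dist_norm norm_minus_commute)
        have "\<bar>norm (x' + v) - norm (x' + m)\<bar> \<le> norm (v - m)"
          using norm_triangle_ineq3[of "x' + v" "x' + m"] by simp
        then show ?thesis
          using profile_lipschitz[OF p, of v m] x'(2)[OF m(1)] m(2) s0 by linarith
      next
        case False
        then obtain b where b: "b \<in> F" "8 / \<delta> < \<bar>c b\<bar>"
          by force
        have "\<bar>c b\<bar> \<le> (\<Sum>a\<in>F. \<bar>c a\<bar>)"
          using F b(1) by (intro member_le_sum) auto
        then have "\<delta> / 4 * (8 / \<delta>) \<le> \<delta> / 4 * (\<Sum>a\<in>F. \<bar>c a\<bar>)"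
          using b \<delta> by (intro mult_left_mono) auto
        then have "2 \<le> \<delta> / 4 * (\<Sum>a\<in>F. \<bar>c a\<bar>)"
          using \<delta> by simp
        moreover have "\<bar>norm (x' + v) - p v\<bar> \<le> 2"
          using norm_triangle_ineq3[of "x' + v" v] x'(1) profile_near_norm[OF p, of v] by simp
        ultimately show ?thesis
          using \<eta> by linarith
      qed
      then show ?thesis
        by (simp add: v_def)
    qed
    show "\<exists>g\<in>carrier Aut. (\<forall>a\<in>F. norm (blinfun_apply g a - a) < \<delta>) \<and> norm (blinfun_apply g x' - x) < \<eta>"
    proof -
      \<comment> \<open>\<open>None\<close> is the place of the moved point. The tags keep it apart
        from F even when x or x' lies in F.\<close>
      define I where "I = insert None (Some ` F)"
      define s where "s i = (case i of None \<Rightarrow> x' | Some a \<Rightarrow> a)" for i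
      define t where "t i = (case i of None \<Rightarrow> x | Some a \<Rightarrow> a)" for i
      \<comment> \<open>These are the errors of x' and of x added up: \<open>\<eta> / 2\<close> for
        the point and twice \<open>\<delta> / 4\<close> for each vector of F. The other halves of
        \<eta> and \<delta> are left for the matching.\<close>
      define w where "w i = (case i of None \<Rightarrow> \<eta> / 2 | Some a \<Rightarrow> \<delta> / 2)" for i :: "'g option"
      have I: "finite I"
        using F by (simp add: I_def)
      have sum_I: "(\<Sum>i\<in>I. f i) = f None + (\<Sum>a\<in>F. f (Some a))" for f :: "'g option \<Rightarrow> 'b::comm_monoid_add"
        using F by (simp add: I_def sum.reindex)
      have w: "w i > 0" if "i \<in> I" for i
        using \<delta> \<eta> by (simp add: w_def split: option.split)
      have \<epsilon>: "min (\<delta> / 2) (\<eta> / 2) > 0"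
        using \<delta> \<eta> by simp
      have close: "\<bar>norm (\<Sum>i\<in>I. c i *\<^sub>R s i) - norm (\<Sum>i\<in>I. c i *\<^sub>R t i)\<bar> \<le> (\<Sum>i\<in>I. w i * \<bar>c i\<bar>)" for c
      proof (cases "c None = 0")
        case True
        then have "(\<Sum>i\<in>I. c i *\<^sub>R s i) = (\<Sum>i\<in>I. c i *\<^sub>R t i)"
          by (simp add: sum_I s_def t_def)
        moreover have "0 \<le> (\<Sum>i\<in>I. w i * \<bar>c i\<bar>)"
          using w by (intro sum_nonneg mult_nonneg_nonneg) (auto simp: order.strict_implies_order)
        ultimately show ?thesis
          by simp
      next
        case False
        \<comment> \<open>Both estimates are for combinations in which the point has coefficient 1;
          homogeneity reduces to this case.\<close>
        define l where "l = c None"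
        define d where "d a = c (Some a) / l" for a
        define v where "v = (\<Sum>a\<in>F. d a *\<^sub>R a)"
        have c: "c (Some a) = l * d a" for a
          using False by (simp add: d_def l_def)
        have sx: "(\<Sum>i\<in>I. c i *\<^sub>R s i) = l *\<^sub>R (x' + v)" and tx: "(\<Sum>i\<in>I. c i *\<^sub>R t i) = l *\<^sub>R (x + v)"
          by (simp_all add: sum_I s_def t_def c v_def scaleR_add_right scaleR_sum_right flip: l_def)
        have "\<bar>norm (x' + v) - norm (x + v)\<bar> \<le> \<eta> / 2 + \<delta> / 2 * (\<Sum>a\<in>F. \<bar>d a\<bar>)"
          using near[of d] x(2)[of d] unfolding v_def by linarith
        then have "\<bar>l\<bar> * \<bar>norm (x' + v) - norm (x + v)\<bar> \<le> \<bar>l\<bar> * (\<eta> / 2 + \<delta> / 2 * (\<Sum>a\<in>F. \<bar>d a\<bar>))"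
          by (rule mult_left_mono) simp
        moreover have "\<bar>l\<bar> * (\<eta> / 2 + \<delta> / 2 * (\<Sum>a\<in>F. \<bar>d a\<bar>)) = (\<Sum>i\<in>I. w i * \<bar>c i\<bar>)"
          by (simp add: sum_I w_def c abs_mult sum_distrib_left algebra_simps flip: l_def)
        ultimately show ?thesis
          by (simp add: sx tx abs_mult flip: right_diff_distrib)
      qed
      obtain g where g: "g \<in> carrier Aut"
          "\<And>i. i \<in> I \<Longrightarrow> norm (blinfun_apply g (s i) - t i) < w i + min (\<delta> / 2) (\<eta> / 2)"
        using automorphism_matching_tuples[OF hom univ I w \<epsilon> close] by blast
      have "norm (blinfun_apply g a - a) < \<delta>" if "a \<in> F" for a
        using g(2)[of "Some a"] that by (simp add: I_def s_def t_def w_def)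
      moreover have "norm (blinfun_apply g x' - x) < \<eta>"
        using g(2)[of None] by (simp add: I_def s_def t_def w_def)
      ultimately show ?thesis
        using g(1) by blast
    qed
  qed (use M \<eta> in auto)
qed

section \<open>The compact space of profiles and its action\<close>

lemma compact_profiles: "compact (profiles :: ('a::real_normed_vector \<Rightarrow> real) set)"
proof -
  define Q where "Q = (\<Pi>\<^sub>E e\<in>UNIV. {norm e - 1 .. norm e + 1} :: ('a \<Rightarrow> real) set)"
  have "compactin (product_topology (\<lambda>_. euclideanreal) UNIV) Q"
    unfolding Q_def by (subst compactin_PiE) (simp add: compactin_euclidean_iff)
  then have "compact Q"
    by (simp add: euclidean_product_topology flip: compactin_euclidean_iff)
  moreover have "profiles \<subseteq> Q"
  proof
    fix p :: "'a \<Rightarrow> real" assume p: "p \<in> profiles"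
    have "norm e - 1 \<le> p e" "p e \<le> norm e + 1" for e
      using profile_near_norm[OF p, of e] by linarith+
    then show "p \<in> Q"
      by (simp add: Q_def PiE_iff)
  qed
  moreover have "closed (profiles :: ('a \<Rightarrow> real) set)"
    by (simp add: profiles_def)
  ultimately show ?thesis
    using compact_Int_closed[of Q profiles] by (simp add: Int_absorb1)
qed

lemma distance_profile_in_profiles: "norm x = 1 \<Longrightarrow> distance_profile x \<in> profiles"
  unfolding profiles_def by (rule subsetD[OF closure_subset]) auto

lemma continuous_map_into_fun:
  fixes f :: "'y \<Rightarrow> 'a \<Rightarrow> 'b::topological_space"
  shows "continuous_map Y euclidean f \<longleftrightarrow> (\<forall>e. continuous_map Y euclidean (\<lambda>y. f y e))"
  unfolding euclidean_product_topology[symmetric] continuous_map_componentwise_UNIV ..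

text \<open>Evaluation of a function at a varying point is in general not continuous for the
  pointwise topology. A common Lipschitz constant repairs this, and continuity of the action on
  profiles depends on it.\<close>

lemma continuous_map_lipschitz_apply:
  fixes g :: "'y \<Rightarrow> 'a::real_normed_vector"
  assumes P: "\<And>e. continuous_map Y euclideanreal (\<lambda>y. P y e)" and g: "continuous_map Y euclidean g"
    and lip: "\<And>y e f. y \<in> topspace Y \<Longrightarrow> \<bar>P y e - P y f\<bar> \<le> norm (e - f)"
  shows "continuous_map Y euclideanreal (\<lambda>y. P y (g y))"
proof -
  have "\<exists>U. openin Y U \<and> y \<in> U \<and> (\<forall>w\<in>U. dist (P y (g y)) (P w (g w)) < \<epsilon>)"
    if y: "y \<in> topspace Y" and \<epsilon>: "\<epsilon> > 0" for y and \<epsilon> :: real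
  proof (intro exI conjI ballI)
    let ?U = "{w \<in> topspace Y. g w \<in> ball (g y) (\<epsilon> / 2)} \<inter>
        {w \<in> topspace Y. P w (g y) \<in> ball (P y (g y)) (\<epsilon> / 2)}"
    show "openin Y ?U"
      using P g by (intro openin_Int openin_continuous_map_preimage[where Y = euclidean]) auto
    show "y \<in> ?U"
      using y \<epsilon> by simp
    show "dist (P y (g y)) (P w (g w)) < \<epsilon>" if w: "w \<in> ?U" for w
    proof -
      have "\<bar>P w (g y) - P w (g w)\<bar> < \<epsilon> / 2"
        using lip[of w "g y" "g w"] w by (auto simp: dist_norm)
      moreover have "\<bar>P y (g y) - P w (g y)\<bar> < \<epsilon> / 2"
        using w by (auto simp: dist_real_def)
      ultimately show ?thesis
        unfolding dist_real_def by linarith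
    qed
  qed
  then show ?thesis
    using Met_TC.continuous_map_to_metric[of Y "\<lambda>y. P y (g y)"] by auto
qed

text \<open>The inverse appears because the norm of T x + e equals that of x + e', where e' is the
  inverse image of e under T.\<close>

definition profile_action :: "('a::real_normed_vector \<Rightarrow>\<^sub>L 'a) \<Rightarrow> ('a \<Rightarrow> real) \<Rightarrow> 'a \<Rightarrow> real" where
  "profile_action T = (\<lambda>p\<in>profiles. \<lambda>e. p (blinfun_apply (inv\<^bsub>Aut\<^esub> T) e))"

lemma Aut_apply:
  fixes S T :: "'a::real_normed_vector \<Rightarrow>\<^sub>L 'a"
  shows "blinfun_apply (S \<otimes>\<^bsub>Aut\<^esub> T) x = blinfun_apply S (blinfun_apply T x)"
    and "blinfun_apply \<one>\<^bsub>Aut\<^esub> x = x"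
    and "T \<in> carrier Aut \<Longrightarrow> blinfun_apply (inv\<^bsub>Aut\<^esub> T) (blinfun_apply T x) = x"
    and "T \<in> carrier Aut \<Longrightarrow> blinfun_apply T (blinfun_apply (inv\<^bsub>Aut\<^esub> T) x) = x"
proof -
  interpret group "Aut :: ('a \<Rightarrow>\<^sub>L 'a) monoid"
    by (rule group_Aut)
  show mult: "blinfun_apply (S \<otimes>\<^bsub>Aut\<^esub> T) x = blinfun_apply S (blinfun_apply T x)" for S T :: "'a \<Rightarrow>\<^sub>L 'a" and x
    by (simp add: Aut_def)
  show one: "blinfun_apply \<one>\<^bsub>Aut\<^esub> x = x" for x :: 'a
    by (simp add: Aut_def)
  show "blinfun_apply (inv\<^bsub>Aut\<^esub> T) (blinfun_apply T x) = x" if "T \<in> carrier Aut"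
    using l_inv[OF that] by (metis mult one)
  show "blinfun_apply T (blinfun_apply (inv\<^bsub>Aut\<^esub> T) x) = x" if "T \<in> carrier Aut"
    using r_inv[OF that] by (metis mult one)
qed

lemma distance_profile_Aut:
  fixes T :: "'a::real_normed_vector \<Rightarrow>\<^sub>L 'a"
  assumes "T \<in> carrier Aut"
  shows "distance_profile (blinfun_apply T x) e = distance_profile x (blinfun_apply (inv\<^bsub>Aut\<^esub> T) e)"
proof -
  have "blinfun_apply T x + e = blinfun_apply T (x + blinfun_apply (inv\<^bsub>Aut\<^esub> T) e)"
    using assms by (simp add: blinfun.add_right Aut_apply(4))
  then show ?thesis
    using assms by (simp add: distance_profile_def Aut_iff)
qed

text \<open>Composition with the inverse of T is continuous for the pointwise topology and sends the
  profile of x to that of T x, so it preserves the closure.\<close>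

lemma profile_action_closed:
  fixes T :: "'a::real_normed_vector \<Rightarrow>\<^sub>L 'a"
  assumes T: "T \<in> carrier Aut" and p: "p \<in> profiles"
  shows "profile_action T p \<in> profiles"
proof -
  let ?f = "\<lambda>p e. p (blinfun_apply (inv\<^bsub>Aut\<^esub> T) e) :: real"
  have "?f ` closure (distance_profile ` unit_sphere) \<subseteq> profiles"
  proof (rule image_closure_subset)
    show "continuous_on (closure (distance_profile ` unit_sphere)) ?f"
      by (intro continuous_on_coordinatewise_then_product continuous_on_subset[OF continuous_on_product_coordinates]) simp
    show "?f ` distance_profile ` unit_sphere \<subseteq> profiles"
    proof clarify
      fix x :: 'a assume "x \<in> unit_sphere"
      then have "norm (blinfun_apply T x) = 1"
        using T by (simp add: Aut_iff)
      moreover have "?f (distance_profile x) = distance_profile (blinfun_apply T x)"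
        by (simp add: fun_eq_iff distance_profile_Aut[OF T])
      ultimately show "?f (distance_profile x) \<in> profiles"
        using distance_profile_in_profiles by simp
    qed
  qed (simp add: profiles_def)
  then show ?thesis
    using p by (auto simp: profile_action_def profiles_def)
qed

text \<open>This is the competitor to which maximality of \<open>K\<close> is applied. Nothing
  specific to the Gurarij space enters here.\<close>

lemma equivariant_compactification_profiles:
  "equivariant_compactification (Aut :: ('a::real_normed_vector \<Rightarrow>\<^sub>L 'a) monoid) Aut_topology
     (top_of_set unit_sphere) sphere_action (top_of_set profiles) profile_action distance_profile"
  unfolding equivariant_compactification_def
proof (intro conjI ballI)
  have top: "topspace (top_of_set (profiles :: ('a \<Rightarrow> real) set)) = profiles"
    by simp
  have comp: "compact_space (top_of_set (profiles :: ('a \<Rightarrow> real) set))"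
    by (rule compact_space_subtopology) (simp add: compact_profiles)
  have haus: "Hausdorff_space (top_of_set (profiles :: ('a \<Rightarrow> real) set))"
    unfolding euclidean_product_topology[symmetric]
    by (intro Hausdorff_space_subtopology) (simp add: Hausdorff_space_product_topology)
  have dp: "distance_profile ` unit_sphere \<subseteq> (profiles :: ('a \<Rightarrow> real) set)"
    using distance_profile_in_profiles by auto
  show "compactification (top_of_set unit_sphere) (top_of_set profiles) (distance_profile :: 'a \<Rightarrow> _)"
    unfolding compactification_def
  proof (intro conjI comp haus)
    have "continuous_on unit_sphere (distance_profile :: 'a \<Rightarrow> _)"
      unfolding distance_profile_def by (intro continuous_on_coordinatewise_then_product continuous_intros)
    then show "continuous_map (top_of_set unit_sphere) (top_of_set profiles) (distance_profile :: 'a \<Rightarrow> _)"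
      using dp by auto
    show "top_of_set profiles closure_of distance_profile ` topspace (top_of_set (unit_sphere :: 'a set)) =
        topspace (top_of_set profiles)"
      using dp by (simp add: closure_of_subtopology Int_absorb1 flip: profiles_def)
  qed
  interpret group "Aut :: ('a \<Rightarrow>\<^sub>L 'a) monoid"
    by (rule group_Aut)
  show "G_space (Aut :: ('a \<Rightarrow>\<^sub>L 'a) monoid) Aut_topology (top_of_set profiles) profile_action"
    unfolding G_space_def
  proof (intro conjI topological_group_Aut haus compact_Hausdorff_completely_regular comp)
    show "group_action (Aut :: ('a \<Rightarrow>\<^sub>L 'a) monoid) (topspace (top_of_set profiles)) profile_action"
      unfolding top
    proof (rule group_actionI[OF group_Aut])
      show "profile_action T \<in> extensional profiles" for T :: "'a \<Rightarrow>\<^sub>L 'a"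
        by (simp add: profile_action_def)
      show "profile_action \<one>\<^bsub>Aut\<^esub> p = p" if "p \<in> profiles" for p :: "'a \<Rightarrow> real"
        using that by (simp add: profile_action_def Aut_apply)
      show "profile_action (S \<otimes>\<^bsub>Aut\<^esub> T) p = profile_action S (profile_action T p)"
        if "S \<in> carrier Aut" "T \<in> carrier Aut" "p \<in> profiles" for S T :: "'a \<Rightarrow>\<^sub>L 'a" and p
        using that profile_action_closed[OF that(2,3)]
        by (simp add: profile_action_def inv_mult_group Aut_apply)
    qed (rule profile_action_closed)
    have inv: "continuous_map Aut_topology Aut_topology (\<lambda>T :: 'a \<Rightarrow>\<^sub>L 'a. inv\<^bsub>Aut\<^esub> T)"
      using topological_group_Aut[where 'a = 'a] by (simp add: topological_group_def)
    let ?Y = "prod_topology Aut_topology (top_of_set (profiles :: ('a \<Rightarrow> real) set))"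
    have "continuous_map ?Y euclideanreal (\<lambda>y. snd y (blinfun_apply (inv\<^bsub>Aut\<^esub> (fst y)) e))" for e
    proof (rule continuous_map_lipschitz_apply[where P = snd and g = "\<lambda>y. blinfun_apply (inv\<^bsub>Aut\<^esub> (fst y)) e"])
      show "continuous_map ?Y euclideanreal (\<lambda>y. snd y f)" for f
      proof -
        have "continuous_map (top_of_set profiles) euclideanreal (\<lambda>p :: 'a \<Rightarrow> real. p f)"
          by (simp add: continuous_on_subset[OF continuous_on_product_coordinates])
        from continuous_map_compose[OF continuous_map_snd this] show ?thesis
          by (simp add: o_def)
      qed
      show "continuous_map ?Y euclidean (\<lambda>y. blinfun_apply (inv\<^bsub>Aut\<^esub> (fst y)) e)"
        by (intro continuous_map_Aut_apply continuous_map_compose[OF continuous_map_fst inv, unfolded o_def]) simp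
      show "\<bar>snd y f - snd y f'\<bar> \<le> norm (f - f')" if "y \<in> topspace ?Y" for y f f'
        using that by (auto intro: profile_lipschitz)
    qed
    then have "continuous_map ?Y euclidean (\<lambda>y e. snd y (blinfun_apply (inv\<^bsub>Aut\<^esub> (fst y)) e))"
      by (simp add: continuous_map_into_fun)
    then have "continuous_map ?Y euclidean (\<lambda>(T, p). profile_action T p)"
      by (rule continuous_map_eq) (auto simp: profile_action_def)
    then show "continuous_map ?Y (top_of_set profiles) (\<lambda>(T, p). profile_action T p)"
      unfolding continuous_map_in_subtopology by (auto intro: profile_action_closed)
  qed
  fix T :: "'a \<Rightarrow>\<^sub>L 'a" and x assume "T \<in> carrier Aut" "x \<in> topspace (top_of_set (unit_sphere :: 'a set))"
  then show "distance_profile (sphere_action T x) = profile_action T (distance_profile x)"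
    using distance_profile_in_profiles[of x]
    by (auto simp: sphere_action_def profile_action_def fun_eq_iff distance_profile_Aut)
qed

section \<open>The maximal equivariant compactification\<close>

text \<open>The strong operator topology is pulled back from a product topology, so a basic
  neighbourhood restricts finitely many vectors. These form F, and \<delta> is the smallest of their
  radii, capped at 1 so that an empty F is covered.\<close>

lemma Aut_topology_neighbourhood_one:
  fixes V :: "('a::real_normed_vector \<Rightarrow>\<^sub>L 'a) set"
  assumes V: "openin Aut_topology V" and one: "\<one>\<^bsub>Aut\<^esub> \<in> V"
  obtains F \<delta> where "finite F" "\<delta> > 0"
    "\<And>g. g \<in> carrier Aut \<Longrightarrow> (\<And>a. a \<in> F \<Longrightarrow> norm (blinfun_apply g a - a) < \<delta>) \<Longrightarrow> g \<in> V"
proof -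
  obtain U where U: "open U" "V = blinfun_apply -` U \<inter> carrier Aut"
    using V by (auto simp: Aut_topology_def strong_operator_topology_def openin_subtopology openin_pullback_topology)
  have "(\<lambda>a. a) \<in> U"
    using one U(2) by (simp add: Aut_def id_blinfun.rep_eq)
  then obtain X where X: "(\<lambda>a. a) \<in> (\<Pi>\<^sub>E a\<in>UNIV. X a)" "\<And>a. open (X a)" "finite {a. X a \<noteq> UNIV}"
      "(\<Pi>\<^sub>E a\<in>UNIV. X a) \<subseteq> U"
    using product_topology_open_contains_basis[of "\<lambda>_. euclidean" UNIV U "\<lambda>a. a"] U(1)
    by (auto simp: open_fun_def)
  have "\<exists>r>0. ball a r \<subseteq> X a" for a
    using X(1,2) open_contains_ball[of "X a"] by (auto simp: PiE_iff)
  then obtain r where r: "\<And>a. r a > 0" "\<And>a. ball a (r a) \<subseteq> X a"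
    by metis
  define F where "F = {a. X a \<noteq> UNIV}"
  define \<delta> where "\<delta> = Min (insert 1 (r ` F))"
  have F: "finite F"
    using X(3) by (simp add: F_def)
  show ?thesis
  proof
    show "\<delta> > 0"
      using F r(1) by (simp add: \<delta>_def)
    fix g :: "'a \<Rightarrow>\<^sub>L 'a"
    assume g: "g \<in> carrier Aut" "\<And>a. a \<in> F \<Longrightarrow> norm (blinfun_apply g a - a) < \<delta>"
    have "blinfun_apply g a \<in> X a" for a
    proof (cases "a \<in> F")
      case True
      then have "\<delta> \<le> r a"
        using F by (simp add: \<delta>_def)
      then have "blinfun_apply g a \<in> ball a (r a)"
        using g(2)[OF True] by (simp add: dist_norm norm_minus_commute)
      then show ?thesis
        using r(2) by blast
    qed (simp add: F_def)
    then have "blinfun_apply g \<in> U"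
      using X(4) by (auto simp: PiE_iff)
    then show "g \<in> V"
      using g(1) U(2) by simp
  qed (rule F)
qed

text \<open>The difference vanishes at the unit of the group, and the tube lemma around the unit
  times \<open>K\<close> yields one neighbourhood for all points of \<open>K\<close>.\<close>

lemma G_space_compact_almost_invariant:
  assumes GK: "G_space G T K \<psi>" and K: "compact_space K"
    and h: "continuous_map K euclideanreal h" and \<epsilon>: "\<epsilon> > 0"
  obtains V where "openin T V" "\<one>\<^bsub>G\<^esub> \<in> V"
    "\<And>g k. g \<in> V \<Longrightarrow> k \<in> topspace K \<Longrightarrow> \<bar>h (\<psi> g k) - h k\<bar> < \<epsilon>"
proof -
  note act = G_spaceD[OF GK]
  interpret group G by (rule act(1))
  define W where "W = {q \<in> topspace (prod_topology T K). h (\<psi> (fst q) (snd q)) - h (snd q) \<in> {-\<epsilon><..<\<epsilon>}}"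
  have "continuous_map (prod_topology T K) euclideanreal (\<lambda>q. h (\<psi> (fst q) (snd q)) - h (snd q))"
  proof (rule continuous_map_diff)
    show "continuous_map (prod_topology T K) euclideanreal (\<lambda>q. h (\<psi> (fst q) (snd q)))"
      using continuous_map_compose[OF act(6) h] by (simp add: o_def case_prod_beta)
    show "continuous_map (prod_topology T K) euclideanreal (\<lambda>q. h (snd q))"
      using continuous_map_compose[OF continuous_map_snd h] by (simp add: o_def)
  qed
  then have W: "openin (prod_topology T K) W"
    unfolding W_def by (rule openin_continuous_map_preimage) simp
  have "{\<one>\<^bsub>G\<^esub>} \<times> topspace K \<subseteq> W"
    using \<epsilon> act(2,4) by (auto simp: W_def)
  then obtain V U where "openin T V" "\<one>\<^bsub>G\<^esub> \<in> V" "topspace K \<subseteq> U" "V \<times> U \<subseteq> W"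
    using tube_lemma_right[OF W, of "topspace K" "\<one>\<^bsub>G\<^esub>"] K act(2) by (auto simp: compact_space_def)
  then show ?thesis
    using that[of V] by (fastforce simp: W_def abs_less_iff)
qed

lemma compactification_approx:
  assumes "compactification X K \<nu>" "openin K U" "k \<in> U"
  obtains x where "x \<in> topspace X" "\<nu> x \<in> U"
proof -
  have "k \<in> K closure_of (\<nu> ` topspace X)"
    using assms openin_subset by (fastforce simp: compactification_def)
  then show ?thesis
    using assms(2,3) that unfolding in_closure_of by blast
qed

text \<open>Let \<open>k\<close> and \<open>l\<close> have the same profile \<open>p\<close>, and realize \<open>p\<close> by a point \<open>x\<close> of the sphere. Points
  \<open>x'\<close> of the sphere near \<open>k\<close>, and likewise those near \<open>l\<close>, are moved near \<open>x\<close> by automorphisms close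
  to the identity. Hence \<open>h\<close> is almost the same at \<open>k\<close>, at \<open>\<nu> x\<close> and at \<open>l\<close>. How near to \<open>x\<close> one has
  to be depends on \<open>x\<close>, so it matters that \<open>x\<close> is chosen before \<open>x'\<close>.\<close>

lemma profile_map_injective:
  fixes \<nu> :: "'g::banach \<Rightarrow> 'k"
  assumes hom: "approximately_ultrahomogeneous TYPE('g)"
    and univ: "universal_for_finite_dimensional TYPE('g)"
    and ec: "equivariant_compactification Aut Aut_topology (top_of_set unit_sphere) sphere_action K \<psi> \<nu>"
    and \<rho>: "continuous_map K (top_of_set profiles) \<rho>"
    and \<rho>\<nu>: "\<And>x. norm x = 1 \<Longrightarrow> \<rho> (\<nu> x) = distance_profile x"
  shows "inj_on \<rho> (topspace K)"
proof (rule inj_onI, rule ccontr)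
  have comp: "compactification (top_of_set unit_sphere) K \<nu>" and GK: "G_space Aut Aut_topology K \<psi>"
    and eqv: "\<And>g x. g \<in> carrier Aut \<Longrightarrow> norm x = 1 \<Longrightarrow> \<nu> (sphere_action g x) = \<psi> g (\<nu> x)"
    using ec by (auto simp: equivariant_compactification_def)
  have cK: "compact_space K" and hK: "Hausdorff_space K"
    and \<nu>: "continuous_map (top_of_set unit_sphere) K \<nu>"
    using comp by (auto simp: compactification_def)
  fix k l assume kl: "k \<in> topspace K" "l \<in> topspace K" "\<rho> k = \<rho> l" "k \<noteq> l"
  define p where "p = \<rho> k"
  have p: "p \<in> profiles"
    using \<rho> kl(1) by (auto simp: p_def continuous_map_def)
  have "completely_regular_space K"
    by (rule compact_Hausdorff_completely_regular[OF cK hK])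
  moreover have "closedin K {l}"
    using kl(2) by (simp add: closedin_Hausdorff_sing_eq[OF hK])
  moreover have "k \<in> topspace K - {l}"
    using kl by simp
  ultimately obtain h :: "'k \<Rightarrow> real" where "continuous_map K (top_of_set {0..1}) h" "h k = 0" "h ` {l} \<subseteq> {1}"
    unfolding completely_regular_space_def by blast
  then have h: "continuous_map K euclideanreal h" "h k = 0" "h l = 1"
    by (auto simp: continuous_map_in_subtopology)
  \<comment> \<open>Both h k and h l will be within 3 \<epsilon> of h at \<nu> x, so 6 \<epsilon> <
    1 contradicts the values 0 and 1.\<close>
  define \<epsilon> where "\<epsilon> = (1 / 8 :: real)"
  have \<epsilon>: "\<epsilon> > 0"
    by (simp add: \<epsilon>_def)
  obtain V where V: "openin Aut_topology V" "\<one>\<^bsub>Aut\<^esub> \<in> V"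
      "\<And>g k. g \<in> V \<Longrightarrow> k \<in> topspace K \<Longrightarrow> \<bar>h (\<psi> g k) - h k\<bar> < \<epsilon>"
    using G_space_compact_almost_invariant[OF GK cK h(1) \<epsilon>] by blast
  obtain F \<delta> where F: "finite F" "\<delta> > 0"
      "\<And>g. g \<in> carrier Aut \<Longrightarrow> (\<And>a. a \<in> F \<Longrightarrow> norm (blinfun_apply g a - a) < \<delta>) \<Longrightarrow> g \<in> V"
    using Aut_topology_neighbourhood_one[OF V(1,2)] by blast
  have "\<delta> / 4 > 0"
    using F(2) by simp
  then obtain x where x: "norm x = 1"
      "\<And>c. \<bar>norm (x + (\<Sum>a\<in>F. c a *\<^sub>R a)) - p (\<Sum>a\<in>F. c a *\<^sub>R a)\<bar> \<le> \<delta> / 4 * (\<Sum>a\<in>F. \<bar>c a\<bar>)"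
    using realize_profile[OF hom univ p F(1)] by blast
  have "continuous_on unit_sphere (\<lambda>x. h (\<nu> x))"
    using continuous_map_compose[OF \<nu> h(1)] by (simp add: o_def)
  then obtain \<eta> where \<eta>: "\<eta> > 0" "\<And>y. norm y = 1 \<Longrightarrow> dist y x < \<eta> \<Longrightarrow> dist (h (\<nu> y)) (h (\<nu> x)) < \<epsilon>"
    using x(1) \<epsilon> unfolding continuous_on_iff by (metis dist_0_norm mem_sphere)
  obtain M \<kappa> where M: "finite M" "\<kappa> > 0"
    "\<And>x'. norm x' = 1 \<Longrightarrow> (\<And>m. m \<in> M \<Longrightarrow> \<bar>norm (x' + m) - p m\<bar> < \<kappa>) \<Longrightarrow>
      \<exists>g\<in>carrier Aut. (\<forall>a\<in>F. norm (blinfun_apply g a - a) < \<delta>) \<and> norm (blinfun_apply g x' - x) < \<eta>"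
    using automorphism_near_profile[OF hom univ p F(1,2) x \<eta>(1)] by blast
  \<comment> \<open>One \<epsilon> for each passage: from j to \<nu> x' by the choice of
    \<open>U\<close>, from \<nu> x' to its image under g by almost invariance, and from there to
    \<nu> x by continuity at x.\<close>
  have near: "\<bar>h j - h (\<nu> x)\<bar> < 3 * \<epsilon>" if j: "j \<in> topspace K" "\<rho> j = p" for j
  proof -
    define U where "U = {i \<in> topspace K. h i \<in> ball (h j) \<epsilon>} \<inter>
        {i \<in> topspace K. \<rho> i \<in> {q. \<forall>m\<in>M. q m \<in> ball (p m) \<kappa>}}"
    have "open {q. \<forall>m\<in>M. q m \<in> ball (p m) \<kappa>}"
      using product_topology_basis'[of M "\<lambda>m. ball (p m) \<kappa>" "\<lambda>m. m"] M(1) by simp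
    then have "openin K U"
      unfolding U_def using h(1) continuous_map_into_fulltopology[OF \<rho>]
      by (intro openin_Int openin_continuous_map_preimage[where Y = euclidean]) auto
    moreover have "j \<in> U"
      using j \<epsilon> M(2) by (simp add: U_def)
    ultimately obtain x' where x': "norm x' = 1" "\<nu> x' \<in> U"
      using compactification_approx[OF comp] by (metis mem_sphere_0 topspace_euclidean_subtopology)
    have "\<bar>norm (x' + m) - p m\<bar> < \<kappa>" if "m \<in> M" for m
      using x' that by (auto simp: U_def \<rho>\<nu> distance_profile_def dist_real_def)
    then obtain g where g: "g \<in> carrier Aut" "\<forall>a\<in>F. norm (blinfun_apply g a - a) < \<delta>"
        "norm (blinfun_apply g x' - x) < \<eta>"
      using M(3)[OF x'(1)] by blast
    have "g \<in> V"
      using F(3) g by blast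
    moreover have "\<nu> x' \<in> topspace K"
      using x'(2) by (simp add: U_def)
    moreover have "\<psi> g (\<nu> x') = \<nu> (blinfun_apply g x')"
      using eqv[OF g(1) x'(1)] x'(1) by (simp add: sphere_action_def)
    ultimately have "\<bar>h (\<nu> (blinfun_apply g x')) - h (\<nu> x')\<bar> < \<epsilon>"
      using V(3)[of g "\<nu> x'"] by simp
    moreover have "dist (h (\<nu> (blinfun_apply g x'))) (h (\<nu> x)) < \<epsilon>"
      using \<eta>(2) g x'(1) by (simp add: dist_norm Aut_iff)
    moreover have "\<bar>h j - h (\<nu> x')\<bar> < \<epsilon>"
      using x'(2) by (simp add: U_def dist_real_def)
    ultimately show ?thesis
      unfolding dist_real_def by linarith
  qed
  from near[of k] near[of l] kl show False
    unfolding h(2,3) by (auto simp: p_def \<epsilon>_def)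
qed

text \<open>Profiles are continuous, so their values along a dense sequence determine them. Sampling
  therefore injects the compact space \<open>K\<close> continuously into
  \<open>nat \<Rightarrow> real\<close>, which is Hausdorff and metrizable, and such a map is an
  embedding.\<close>

lemma metrizable_space_via_profiles:
  fixes \<rho> :: "'k \<Rightarrow> 'a::real_normed_vector \<Rightarrow> real"
  assumes sep: "separable_space (euclidean :: 'a topology)"
    and K: "compact_space K" and \<rho>: "continuous_map K (top_of_set profiles) \<rho>" and inj: "inj_on \<rho> (topspace K)"
  shows "metrizable_space K"
proof -
  obtain C :: "'a set" where C: "countable C" "closure C = UNIV"
    using sep by (auto simp: separable_space_def)
  have "C \<noteq> {}"
    using C(2) by auto
  define d where "d = from_nat_into C"
  have d: "range d = C"
    unfolding d_def by (rule range_from_nat_into) fact+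
  define \<sigma> where "\<sigma> k n = \<rho> k (d n)" for k and n :: nat
  have "continuous_map K euclidean \<sigma>"
    unfolding euclidean_product_topology[symmetric] continuous_map_componentwise_UNIV
  proof
    fix n
    have "continuous_map euclidean euclideanreal (\<lambda>p :: 'a \<Rightarrow> real. p (d n))"
      by (simp add: continuous_on_product_coordinates)
    from continuous_map_compose[OF continuous_map_into_fulltopology[OF \<rho>] this]
    show "continuous_map K euclideanreal (\<lambda>k. \<sigma> k n)"
      by (simp add: o_def \<sigma>_def)
  qed
  moreover have "inj_on \<sigma> (topspace K)"
  proof (rule inj_onI)
    fix k l assume kl: "k \<in> topspace K" "l \<in> topspace K" "\<sigma> k = \<sigma> l"
    then have prof: "\<rho> k \<in> profiles" "\<rho> l \<in> profiles"
      using \<rho> by (auto simp: continuous_map_def)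
    have cont: "continuous_on UNIV p" if "p \<in> profiles" for p :: "'a \<Rightarrow> real"
      unfolding continuous_on_iff
      using profile_lipschitz[OF that] by (metis dist_norm dist_real_def order_le_less_trans)
    have "\<rho> k e = \<rho> l e" for e
    proof -
      have "closed {e. \<rho> k e = \<rho> l e}"
        using prof by (intro closed_Collect_eq cont)
      moreover have "C \<subseteq> {e. \<rho> k e = \<rho> l e}"
        using kl(3) d by (auto simp: \<sigma>_def fun_eq_iff)
      ultimately have "closure C \<subseteq> {e. \<rho> k e = \<rho> l e}"
        by (rule closure_minimal[rotated])
      then show ?thesis
        using C(2) by blast
    qed
    then show "k = l"
      using inj kl by (meson ext inj_onD)
  qed
  moreover have "Hausdorff_space (euclidean :: (nat \<Rightarrow> real) topology)"
    unfolding euclidean_product_topology[symmetric] by (simp add: Hausdorff_space_product_topology)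
  ultimately have "embedding_map K euclidean \<sigma>"
    using K by (intro continuous_imp_embedding_map) auto
  then have "K homeomorphic_space subtopology euclidean (\<sigma> ` topspace K)"
    unfolding embedding_map_def by (rule homeomorphic_map_imp_homeomorphic_space)
  moreover have "metrizable_space (subtopology (euclidean :: (nat \<Rightarrow> real) topology) (\<sigma> ` topspace K))"
    by (intro metrizable_space_subtopology metrizable_space_euclidean)
  ultimately show ?thesis
    using homeomorphic_metrizable_space by blast
qed

section \<open>The Gromov compactification\<close>

text \<open>Every function in the Gromov algebra has the following property, but the distance to twice a
  unit vector does not.\<close>

definition controlled_by_distances :: "'a::metric_space set \<Rightarrow> ('a \<Rightarrow> real) \<Rightarrow> bool" where
  "controlled_by_distances S f \<longleftrightarrow>
     (\<forall>\<epsilon>>0. \<exists>F \<delta>. finite F \<and> F \<subseteq> S \<and> \<delta> > 0 \<and>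
       (\<forall>x\<in>S. \<forall>y\<in>S. (\<forall>z\<in>F. \<bar>dist x z - dist y z\<bar> < \<delta>) \<longrightarrow> \<bar>f x - f y\<bar> < \<epsilon>))"

text \<open>Covers sums, products and, with g = f, scalar multiples: each becomes a question about a
  modulus of uniform continuity.\<close>

lemma controlled_by_distances_combine:
  assumes f: "controlled_by_distances S f" and g: "controlled_by_distances S g"
    and h: "\<And>\<epsilon>. \<epsilon> > 0 \<Longrightarrow> \<exists>\<gamma>>0. \<forall>x\<in>S. \<forall>y\<in>S. \<bar>f x - f y\<bar> < \<gamma> \<longrightarrow> \<bar>g x - g y\<bar> < \<gamma> \<longrightarrow> \<bar>h x - h y\<bar> < \<epsilon>"
  shows "controlled_by_distances S h"
  unfolding controlled_by_distances_def
proof (intro allI impI)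
  fix \<epsilon> :: real assume "\<epsilon> > 0"
  from h[OF this] obtain \<gamma> where \<gamma>: "\<gamma> > 0"
      "\<forall>x\<in>S. \<forall>y\<in>S. \<bar>f x - f y\<bar> < \<gamma> \<longrightarrow> \<bar>g x - g y\<bar> < \<gamma> \<longrightarrow> \<bar>h x - h y\<bar> < \<epsilon>"
    by (elim exE conjE)
  obtain F \<alpha> where F: "finite F" "F \<subseteq> S" "\<alpha> > 0"
      "\<forall>x\<in>S. \<forall>y\<in>S. (\<forall>z\<in>F. \<bar>dist x z - dist y z\<bar> < \<alpha>) \<longrightarrow> \<bar>f x - f y\<bar> < \<gamma>"
    using f[unfolded controlled_by_distances_def, THEN spec, THEN mp, OF \<gamma>(1)] by (elim exE conjE)
  obtain F' \<beta> where F': "finite F'" "F' \<subseteq> S" "\<beta> > 0"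
      "\<forall>x\<in>S. \<forall>y\<in>S. (\<forall>z\<in>F'. \<bar>dist x z - dist y z\<bar> < \<beta>) \<longrightarrow> \<bar>g x - g y\<bar> < \<gamma>"
    using g[unfolded controlled_by_distances_def, THEN spec, THEN mp, OF \<gamma>(1)] by (elim exE conjE)
  have "\<forall>x\<in>S. \<forall>y\<in>S. (\<forall>z\<in>F \<union> F'. \<bar>dist x z - dist y z\<bar> < min \<alpha> \<beta>) \<longrightarrow> \<bar>h x - h y\<bar> < \<epsilon>"
    using F(4) F'(4) \<gamma>(2) by simp
  moreover have "finite (F \<union> F')" "F \<union> F' \<subseteq> S" "min \<alpha> \<beta> > 0"
    using F F' by simp_all
  ultimately show "\<exists>F \<delta>. finite F \<and> F \<subseteq> S \<and> \<delta> > 0 \<and>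
       (\<forall>x\<in>S. \<forall>y\<in>S. (\<forall>z\<in>F. \<bar>dist x z - dist y z\<bar> < \<delta>) \<longrightarrow> \<bar>h x - h y\<bar> < \<epsilon>)"
    by (intro exI conjI)
qed

text \<open>Control means uniform continuity for the uniformity given by finitely many distances at
  a time. The controlled bounded continuous functions form a closed unital subalgebra that contains
  the generators.\<close>

lemma gromov_algebra_controlled:
  fixes S :: "'a::metric_space set"
  assumes S: "bounded S"
    and f: "f \<in> generated_closed_unital_subalgebra (top_of_set S) {(\<lambda>x\<in>S. dist x z) |z. z \<in> S}"
  shows "controlled_by_distances S f"
proof -
  define A where "A = {f \<in> bounded_continuous_functions (top_of_set S). controlled_by_distances S f}"
  \<comment> \<open>The algebra generated by all bounded continuous functions is the set of these
    functions itself. This is how that set is seen to be a closed unital subalgebra.\<close>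
  define B where "B = generated_closed_unital_subalgebra (top_of_set S) (bounded_continuous_functions (top_of_set S))"
  have B: "closed_unital_subalgebra (top_of_set S) B"
    unfolding B_def by (rule closed_unital_subalgebra_generated) simp
  have "B \<subseteq> bounded_continuous_functions (top_of_set S)"
    using B by (simp add: closed_unital_subalgebra_def)
  moreover have "bounded_continuous_functions (top_of_set S) \<subseteq> B"
    by (auto simp: B_def generated_closed_unital_subalgebra_def)
  ultimately have bcf: "closed_unital_subalgebra (top_of_set S) (bounded_continuous_functions (top_of_set S))"
    using B by simp
  let ?C = "bounded_continuous_functions (top_of_set S)"
  have bcf_1: "(\<lambda>x\<in>S. 1) \<in> ?C"
    and bcf_add: "\<forall>f\<in>?C. \<forall>g\<in>?C. (\<lambda>x\<in>S. f x + g x) \<in> ?C"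
    and bcf_mult: "\<forall>f\<in>?C. \<forall>g\<in>?C. (\<lambda>x\<in>S. f x * g x) \<in> ?C"
    and bcf_scale: "\<forall>c. \<forall>f\<in>?C. (\<lambda>x\<in>S. c * f x) \<in> ?C"
    and bcf_lim: "\<forall>s f. (\<forall>n. s n \<in> ?C) \<and> f \<in> extensional S \<and> uniform_limit S s f sequentially \<longrightarrow> f \<in> ?C"
    using bcf[unfolded closed_unital_subalgebra_def topspace_euclidean_subtopology]
    by - (elim conjE, assumption)+
  have bound: "\<exists>b>0. \<forall>x\<in>S. \<bar>f x\<bar> \<le> b" if f: "f \<in> bounded_continuous_functions (top_of_set S)" for f
  proof -
    obtain b where "\<forall>x\<in>S. \<bar>f x\<bar> \<le> b"
      using f by (auto simp: bounded_continuous_functions_iff)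
    then have "\<forall>x\<in>S. \<bar>f x\<bar> \<le> \<bar>b\<bar> + 1"
      by fastforce
    then show ?thesis
      by (intro exI[of _ "\<bar>b\<bar> + 1"]) auto
  qed
  have "closed_unital_subalgebra (top_of_set S) A"
    unfolding closed_unital_subalgebra_def topspace_euclidean_subtopology
  proof (intro conjI ballI allI impI; (elim conjE)?)
    show "A \<subseteq> bounded_continuous_functions (top_of_set S)"
      by (auto simp: A_def)
    have "controlled_by_distances S (\<lambda>x\<in>S. 1)"
      by (auto simp: controlled_by_distances_def intro!: exI[of _ "{}"] exI[of _ 1])
    then show "(\<lambda>x\<in>S. 1) \<in> A"
      using bcf_1 by (simp add: A_def)
  next
    fix f g assume "f \<in> A" "g \<in> A"
    then have f: "f \<in> bounded_continuous_functions (top_of_set S)" "controlled_by_distances S f"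
      and g: "g \<in> bounded_continuous_functions (top_of_set S)" "controlled_by_distances S g"
      by (auto simp: A_def)
    have "controlled_by_distances S (\<lambda>x\<in>S. f x + g x)"
    proof (rule controlled_by_distances_combine[OF f(2) g(2)])
      fix \<epsilon> :: real assume "\<epsilon> > 0"
      moreover have "\<bar>f x + g x - (f y + g y)\<bar> < \<epsilon>" if "\<bar>f x - f y\<bar> < \<epsilon> / 2" "\<bar>g x - g y\<bar> < \<epsilon> / 2" for x y
        using that by linarith
      ultimately show "\<exists>\<gamma>>0. \<forall>x\<in>S. \<forall>y\<in>S. \<bar>f x - f y\<bar> < \<gamma> \<longrightarrow> \<bar>g x - g y\<bar> < \<gamma> \<longrightarrow>
          \<bar>(\<lambda>x\<in>S. f x + g x) x - (\<lambda>x\<in>S. f x + g x) y\<bar> < \<epsilon>"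
        by (intro exI[of _ "\<epsilon> / 2"]) auto
    qed
    then show "(\<lambda>x\<in>S. f x + g x) \<in> A"
      using bcf_add f g by (simp add: A_def)
    obtain a where a: "a > 0" "\<And>x. x \<in> S \<Longrightarrow> \<bar>f x\<bar> \<le> a"
      using bound[OF f(1)] by blast
    obtain b where b: "b > 0" "\<And>x. x \<in> S \<Longrightarrow> \<bar>g x\<bar> \<le> b"
      using bound[OF g(1)] by blast
    have "controlled_by_distances S (\<lambda>x\<in>S. f x * g x)"
    proof (rule controlled_by_distances_combine[OF f(2) g(2)])
      fix \<epsilon> :: real assume \<epsilon>: "\<epsilon> > 0"
      have "\<bar>f x * g x - f y * g y\<bar> < \<epsilon>" if "x \<in> S" "y \<in> S" "\<bar>f x - f y\<bar> < \<epsilon> / (a + b)" "\<bar>g x - g y\<bar> < \<epsilon> / (a + b)" for x y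
      proof -
        have "\<bar>f x * g x - f y * g y\<bar> = \<bar>f x * (g x - g y) + g y * (f x - f y)\<bar>"
          by (simp add: algebra_simps)
        also have "\<dots> \<le> \<bar>f x\<bar> * \<bar>g x - g y\<bar> + \<bar>g y\<bar> * \<bar>f x - f y\<bar>"
          by (metis abs_mult abs_triangle_ineq)
        also have "\<dots> \<le> a * \<bar>g x - g y\<bar> + b * \<bar>f x - f y\<bar>"
          using a b that(1,2) by (intro add_mono mult_right_mono) auto
        also have "\<dots> < a * (\<epsilon> / (a + b)) + b * (\<epsilon> / (a + b))"
          using a b that(3,4) by (intro add_strict_mono mult_strict_left_mono) auto
        also have "\<dots> = (a + b) * (\<epsilon> / (a + b))"
          by (rule distrib_right[symmetric])
        also have "\<dots> = \<epsilon>"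
          using a(1) b(1) by simp
        finally show ?thesis .
      qed
      then show "\<exists>\<gamma>>0. \<forall>x\<in>S. \<forall>y\<in>S. \<bar>f x - f y\<bar> < \<gamma> \<longrightarrow> \<bar>g x - g y\<bar> < \<gamma> \<longrightarrow>
          \<bar>(\<lambda>x\<in>S. f x * g x) x - (\<lambda>x\<in>S. f x * g x) y\<bar> < \<epsilon>"
        using a b \<epsilon> by (intro exI[of _ "\<epsilon> / (a + b)"]) auto
    qed
    then show "(\<lambda>x\<in>S. f x * g x) \<in> A"
      using bcf_mult f g by (simp add: A_def)
  next
    fix c f assume "f \<in> A"
    then have f: "f \<in> bounded_continuous_functions (top_of_set S)" "controlled_by_distances S f"
      by (auto simp: A_def)
    have "controlled_by_distances S (\<lambda>x\<in>S. c * f x)"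
    proof (rule controlled_by_distances_combine[OF f(2) f(2)])
      fix \<epsilon> :: real assume \<epsilon>: "\<epsilon> > 0"
      have "\<bar>c * f x - c * f y\<bar> < \<epsilon>" if "\<bar>f x - f y\<bar> < \<epsilon> / (\<bar>c\<bar> + 1)" for x y
      proof -
        have "\<bar>c * f x - c * f y\<bar> \<le> (\<bar>c\<bar> + 1) * \<bar>f x - f y\<bar>"
          by (simp add: abs_mult mult_right_mono flip: right_diff_distrib)
        also have "\<dots> < (\<bar>c\<bar> + 1) * (\<epsilon> / (\<bar>c\<bar> + 1))"
          using that by (intro mult_strict_left_mono) auto
        finally show ?thesis
          by simp
      qed
      then show "\<exists>\<gamma>>0. \<forall>x\<in>S. \<forall>y\<in>S. \<bar>f x - f y\<bar> < \<gamma> \<longrightarrow> \<bar>f x - f y\<bar> < \<gamma> \<longrightarrow>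
          \<bar>(\<lambda>x\<in>S. c * f x) x - (\<lambda>x\<in>S. c * f x) y\<bar> < \<epsilon>"
        using \<epsilon> by (intro exI[of _ "\<epsilon> / (\<bar>c\<bar> + 1)"]) auto
    qed
    then show "(\<lambda>x\<in>S. c * f x) \<in> A"
      using bcf_scale f by (simp add: A_def)
  next
    fix s f
    assume s: "\<forall>n. s n \<in> A" and ext: "f \<in> extensional S" and lim: "uniform_limit S s f sequentially"
    have "f \<in> bounded_continuous_functions (top_of_set S)"
      using s ext lim by (intro bcf_lim[rule_format, of s]) (simp add: A_def)
    moreover have "controlled_by_distances S f"
      unfolding controlled_by_distances_def
    proof (intro allI impI)
      fix \<epsilon> :: real assume \<epsilon>: "\<epsilon> > 0"
      then have \<epsilon>3: "\<epsilon> / 3 > 0"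
        by simp
      obtain n where n: "\<forall>x\<in>S. dist (s n x) (f x) < \<epsilon> / 3"
        using uniform_limitD[OF lim \<epsilon>3] by (auto simp: eventually_sequentially)
      have sn: "controlled_by_distances S (s n)"
        using s by (simp add: A_def)
      obtain F \<delta> where F: "finite F" "F \<subseteq> S" "\<delta> > 0"
          "\<forall>x\<in>S. \<forall>y\<in>S. (\<forall>z\<in>F. \<bar>dist x z - dist y z\<bar> < \<delta>) \<longrightarrow> \<bar>s n x - s n y\<bar> < \<epsilon> / 3"
        using sn[unfolded controlled_by_distances_def, THEN spec, THEN mp, OF \<epsilon>3] by blast
      have "\<bar>f x - f y\<bar> < \<epsilon>" if "x \<in> S" "y \<in> S" "\<forall>z\<in>F. \<bar>dist x z - dist y z\<bar> < \<delta>" for x y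
      proof -
        have "\<bar>s n x - s n y\<bar> < \<epsilon> / 3"
          using F(4) that by blast
        then show ?thesis
          using bspec[OF n that(1)] bspec[OF n that(2)] unfolding dist_real_def by linarith
      qed
      then show "\<exists>F \<delta>. finite F \<and> F \<subseteq> S \<and> \<delta> > 0 \<and>
          (\<forall>x\<in>S. \<forall>y\<in>S. (\<forall>z\<in>F. \<bar>dist x z - dist y z\<bar> < \<delta>) \<longrightarrow> \<bar>f x - f y\<bar> < \<epsilon>)"
        using F(1-3) by blast
    qed
    ultimately show "f \<in> A"
      by (simp add: A_def)
  qed
  moreover have "{(\<lambda>x\<in>S. dist x z) |z. z \<in> S} \<subseteq> A"
  proof clarify
    fix z assume z: "z \<in> S"
    obtain b where "\<forall>x\<in>S. dist x z \<le> b"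
      using S z unfolding bounded_any_center[where a = z] by (auto simp: dist_commute)
    moreover have "continuous_on S (\<lambda>x. dist x z)"
      by (intro continuous_intros)
    ultimately have "(\<lambda>x\<in>S. dist x z) \<in> bounded_continuous_functions (top_of_set S)"
      using bounded_continuous_functions_restrict[of "top_of_set S" "\<lambda>x. dist x z" b] by simp
    moreover have "controlled_by_distances S (\<lambda>x\<in>S. dist x z)"
      unfolding controlled_by_distances_def
    proof (intro allI impI)
      fix \<epsilon> :: real assume "\<epsilon> > 0"
      then show "\<exists>F \<delta>. finite F \<and> F \<subseteq> S \<and> \<delta> > 0 \<and>
          (\<forall>x\<in>S. \<forall>y\<in>S. (\<forall>z\<in>F. \<bar>dist x z - dist y z\<bar> < \<delta>) \<longrightarrow>
            \<bar>(\<lambda>x\<in>S. dist x z) x - (\<lambda>x\<in>S. dist x z) y\<bar> < \<epsilon>)"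
        using z by (intro exI[of _ "{z}"] exI[of _ \<epsilon>]) auto
    qed
    ultimately show "(\<lambda>x\<in>S. dist x z) \<in> A"
      by (simp add: A_def)
  qed
  ultimately have "generated_closed_unital_subalgebra (top_of_set S) {(\<lambda>x\<in>S. dist x z) |z. z \<in> S} \<subseteq> A"
    unfolding generated_closed_unital_subalgebra_def by (intro Inter_lower) simp
  then have "f \<in> A"
    using f by (rule subsetD)
  then show ?thesis
    by (simp add: A_def)
qed

text \<open>Two norms on the direct sum with a line that extend the given norm. They give the extra unit
  vector the same distance, 3/2, to all points of the unit sphere, but the distances 2 and 5/2 to
  the vectors of norm 2.\<close>

lemma vector_norm_direct_sum:
  shows "vector_norm (\<lambda>(e :: 'a::real_normed_vector, l :: real). max (\<bar>l\<bar> + norm e / 2) (norm e))" (is "vector_norm ?N1")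
    and "vector_norm (\<lambda>(e :: 'a::real_normed_vector, l :: real). max \<bar>l\<bar> (norm e + \<bar>l\<bar> / 2))" (is "vector_norm ?N2")
proof -
  have scale: "\<bar>a\<bar> * max r s = max (\<bar>a\<bar> * r) (\<bar>a\<bar> * s)" for a r s :: real
    by (simp add: max_mult_distrib_left)
  have tri: "norm (fst (y + z)) \<le> norm (fst y) + norm (fst z)" "\<bar>snd (y + z)\<bar> \<le> \<bar>snd y\<bar> + \<bar>snd z\<bar>"
    for y z :: "'a \<times> real"
    by (simp_all add: norm_triangle_ineq)
  have zero: "norm (fst z) = 0 \<Longrightarrow> snd z = 0 \<Longrightarrow> z = 0" for z :: "'a \<times> real"
    by (simp add: prod_eq_iff)
  show "vector_norm ?N1"
    unfolding vector_norm_def case_prod_beta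
  proof (intro conjI allI)
    fix y z :: "'a \<times> real" and a :: real
    let ?N = "\<lambda>z. max (\<bar>snd z\<bar> + norm (fst z) / 2) (norm (fst z))"
    show "0 \<le> ?N z"
      by (simp add: le_max_iff_disj)
    show "?N z = 0 \<longleftrightarrow> z = 0"
    proof
      assume "?N z = 0"
      then have "norm (fst z) = 0" "snd z = 0"
        using norm_ge_zero[of "fst z"] by (auto simp: max_def split: if_splits)
      then show "z = 0" by (rule zero)
    qed simp
    show "?N (a *\<^sub>R z) = \<bar>a\<bar> * ?N z"
      by (simp add: scale abs_mult distrib_left)
    show "?N (y + z) \<le> ?N y + ?N z"
      using tri[of y z] by linarith
  qed
  show "vector_norm ?N2"
    unfolding vector_norm_def case_prod_beta
  proof (intro conjI allI)
    fix y z :: "'a \<times> real" and a :: real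
    let ?N = "\<lambda>z. max \<bar>snd z\<bar> (norm (fst z) + \<bar>snd z\<bar> / 2)"
    show "0 \<le> ?N z"
      by (simp add: le_max_iff_disj)
    show "?N z = 0 \<longleftrightarrow> z = 0"
    proof
      assume "?N z = 0"
      then have "norm (fst z) = 0" "snd z = 0"
        using norm_ge_zero[of "fst z"] by (auto simp: max_def split: if_splits)
      then show "z = 0" by (rule zero)
    qed simp
    show "?N (a *\<^sub>R z) = \<bar>a\<bar> * ?N z"
      by (simp add: scale abs_mult distrib_left)
    show "?N (y + z) \<le> ?N y + ?N z"
      using tri[of y z] by linarith
  qed
qed

text \<open>Realizing both extensions over F and z0 gives points x and y whose distances to the
  vectors of F are all close to 3/2, whereas f is close to 2 at x and to 5/2 at y.\<close>

lemma distance_to_double_not_controlled: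
  fixes z0 :: "'g::banach"
  assumes hom: "approximately_ultrahomogeneous TYPE('g)"
    and univ: "universal_for_finite_dimensional TYPE('g)"
    and z0: "norm z0 = 1" and f: "\<And>x. norm x = 1 \<Longrightarrow> f x = dist x (2 *\<^sub>R z0)"
  shows "\<not> controlled_by_distances unit_sphere f"
proof
  assume "controlled_by_distances unit_sphere f"
  then obtain F \<delta> where F: "finite F" "F \<subseteq> unit_sphere" "\<delta> > 0"
    and ctrl: "\<And>x y. norm x = 1 \<Longrightarrow> norm y = 1 \<Longrightarrow> (\<forall>z\<in>F. \<bar>dist x z - dist y z\<bar> < \<delta>) \<Longrightarrow> \<bar>f x - f y\<bar> < 1 / 4"
    unfolding controlled_by_distances_def by (metis mem_sphere_0 zero_less_divide_1_iff zero_less_numeral)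
  \<comment> \<open>The bound \<open>\<delta> / 4\<close> keeps the distances to F within \<delta>
    of each other. With \<open>1 / 32\<close> the two values of f are off by at most 1/16 each, so
    they still differ by 3/8, more than 1/4.\<close>
  define \<eta> where "\<eta> = min (\<delta> / 4) (1 / 32)"
  have \<eta>: "\<eta> > 0"
    using F(3) by (simp add: \<eta>_def)
  have fin: "finite (insert z0 F)"
    using F(1) by simp
  \<comment> \<open>Coefficients supported at one z turn the estimate for combinations into one for
    the multiples of z.\<close>
  have single: "(\<Sum>a\<in>insert z0 F. (if a = z then r else 0) *\<^sub>R a) = r *\<^sub>R z"
    "(\<Sum>a\<in>insert z0 F. \<bar>if a = z then r else 0\<bar>) = \<bar>r\<bar>" if "z \<in> insert z0 F" for z and r :: real
  proof -
    have "(\<Sum>a\<in>insert z0 F. (if a = z then r else 0) *\<^sub>R a) = (\<Sum>a\<in>insert z0 F. if a = z then r *\<^sub>R z else 0)"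
      "(\<Sum>a\<in>insert z0 F. \<bar>if a = z then r else 0\<bar>) = (\<Sum>a\<in>insert z0 F. if a = z then \<bar>r\<bar> else 0)"
      by (intro sum.cong; simp)+
    then show "(\<Sum>a\<in>insert z0 F. (if a = z then r else 0) *\<^sub>R a) = r *\<^sub>R z"
      "(\<Sum>a\<in>insert z0 F. \<bar>if a = z then r else 0\<bar>) = \<bar>r\<bar>"
      using fin that by (simp_all only: sum.delta if_True)
  qed
  have realize: "\<exists>x. norm x = N (0, 1) \<and> (\<forall>z\<in>insert z0 F. \<forall>r. \<bar>dist x (r *\<^sub>R z) - N (- (r *\<^sub>R z), 1)\<bar> \<le> \<eta> * \<bar>r\<bar>)"
    if N: "vector_norm N" "\<And>e. N (e, 0) = norm e" for N :: "'g \<times> real \<Rightarrow> real"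
  proof -
    obtain x where x: "norm x = N (0, 1)"
      "\<And>c. \<bar>norm (x + (\<Sum>a\<in>insert z0 F. c a *\<^sub>R a)) - N (\<Sum>a\<in>insert z0 F. c a *\<^sub>R a, 1)\<bar> \<le> \<eta> * (\<Sum>a\<in>insert z0 F. \<bar>c a\<bar>)"
      using realize_one_point_extension[OF hom univ N fin \<eta>] by blast
    have "\<bar>dist x (r *\<^sub>R z) - N (- (r *\<^sub>R z), 1)\<bar> \<le> \<eta> * \<bar>r\<bar>" if "z \<in> insert z0 F" for z r
      using x(2)[of "\<lambda>a. if a = z then - r else 0"] unfolding single[OF that, of "- r"]
      by (simp add: dist_norm)
    then show ?thesis
      using x(1) by blast
  qed
  obtain x where x: "norm x = 1"
      "\<And>z r. z \<in> insert z0 F \<Longrightarrow> \<bar>dist x (r *\<^sub>R z) - max (1 + norm (r *\<^sub>R z) / 2) (norm (r *\<^sub>R z))\<bar> \<le> \<eta> * \<bar>r\<bar>"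
    using realize[OF vector_norm_direct_sum(1)] by auto
  obtain y where y: "norm y = 1"
      "\<And>z r. z \<in> insert z0 F \<Longrightarrow> \<bar>dist y (r *\<^sub>R z) - max 1 (norm (r *\<^sub>R z) + 1 / 2)\<bar> \<le> \<eta> * \<bar>r\<bar>"
    using realize[OF vector_norm_direct_sum(2)] by auto
  have "\<bar>dist x z - dist y z\<bar> < \<delta>" if "z \<in> F" for z
  proof -
    have "norm z = 1"
      using F(2) that by auto
    then have "\<bar>dist x z - 3 / 2\<bar> \<le> \<eta>" "\<bar>dist y z - 3 / 2\<bar> \<le> \<eta>"
      using x(2)[of z 1] y(2)[of z 1] that by auto
    moreover have "\<eta> \<le> \<delta> / 4"
      by (simp add: \<eta>_def)
    ultimately show ?thesis
      using F(3) by linarith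
  qed
  then have "\<bar>f x - f y\<bar> < 1 / 4"
    using ctrl x(1) y(1) by blast
  moreover have "\<bar>f x - 2\<bar> \<le> \<eta> * 2" "\<bar>f y - 5 / 2\<bar> \<le> \<eta> * 2"
    using x(2)[of z0 2] y(2)[of z0 2] z0 by (simp_all add: f x(1) y(1))
  moreover have "\<eta> \<le> 1 / 32"
    by (simp add: \<eta>_def)
  ultimately show False
    by linarith
qed

theorem theorem4p11:
  fixes K :: "'k topology" and K' :: "'l topology"
    and \<psi> :: "('g::banach \<Rightarrow>\<^sub>L 'g) \<Rightarrow> 'k \<Rightarrow> 'k"
    and \<nu> :: "'g \<Rightarrow> 'k" and \<nu>' :: "'g \<Rightarrow> 'l"
  assumes "gurarij_space TYPE('g)"
    and "maximal_equivariant_compactification Aut Aut_topology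
           (top_of_set unit_sphere) sphere_action K \<psi> \<nu>"
    and "gromov_compactification unit_sphere dist K' \<nu>'"
  shows "metrizable_space K \<and>
         \<not> compactification_equiv (top_of_set unit_sphere) K \<nu> K' \<nu>'"
proof
  have sep: "separable_space (euclidean :: 'g topology)"
    and hom: "approximately_ultrahomogeneous TYPE('g)"
    and univ: "universal_for_finite_dimensional TYPE('g)"
    using assms(1) by (auto simp: gurarij_space_def)
  have ec: "equivariant_compactification Aut Aut_topology (top_of_set unit_sphere) sphere_action K \<psi> \<nu>"
    using assms(2) by (simp add: maximal_equivariant_compactification_def)
  have fac: "compactification_factor (top_of_set unit_sphere) K \<nu> (top_of_set profiles) distance_profile"
    by (rule maximal_equivariant_compactification_factor[OF assms(2) equivariant_compactification_profiles])
  then obtain \<rho> where \<rho>: "continuous_map K (top_of_set profiles) \<rho>"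
      "\<And>x. norm x = 1 \<Longrightarrow> \<rho> (\<nu> x) = distance_profile x"
    by (auto simp: compactification_factor_def)
  show "metrizable_space K"
  proof (rule metrizable_space_via_profiles[OF sep _ \<rho>(1)])
    show "compact_space K"
      using ec by (simp add: equivariant_compactification_def compactification_def)
  qed (rule profile_map_injective[OF hom univ ec \<rho>])
  show "\<not> compactification_equiv (top_of_set unit_sphere) K \<nu> K' \<nu>'"
  proof
    assume "compactification_equiv (top_of_set unit_sphere) K \<nu> K' \<nu>'"
    then have "compactification_factor (top_of_set unit_sphere) K' \<nu>' (top_of_set profiles) distance_profile"
      using fac compactification_factor_trans unfolding compactification_equiv_def by blast
    then obtain \<pi> where \<pi>: "continuous_map K' (top_of_set profiles) \<pi>"
        "\<And>x. norm x = 1 \<Longrightarrow> \<pi> (\<nu>' x) = distance_profile x"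
      by (auto simp: compactification_factor_def)
    \<comment> \<open>A unit vector exists: extend the norm over the empty set of vectors.\<close>
    obtain z0 :: 'g where "norm z0 = max (\<bar>1\<bar> + norm (0 :: 'g) / 2) (norm (0 :: 'g))"
      using realize_one_point_extension[OF hom univ vector_norm_direct_sum(1), of "{}" 1] by auto
    then have z0: "norm z0 = 1"
      by simp
    \<comment> \<open>On the profile of x this evaluation is the distance from x to twice z0. If the
      profile map factored through \<open>K'\<close>, that distance would belong to the Gromov
      algebra.\<close>
    have "continuous_map euclidean euclideanreal (\<lambda>p :: 'g \<Rightarrow> real. p (- 2 *\<^sub>R z0))"
      by (simp add: continuous_on_product_coordinates)
    then have \<pi>z: "continuous_map K' euclideanreal (\<lambda>k. \<pi> k (- 2 *\<^sub>R z0))"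
      by (rule continuous_map_compose[OF continuous_map_into_fulltopology[OF \<pi>(1)], unfolded o_def])
    have "{(\<lambda>x\<in>unit_sphere. h (\<nu>' x)) |h. continuous_map K' euclideanreal h} =
        generated_closed_unital_subalgebra (top_of_set unit_sphere) {(\<lambda>x\<in>unit_sphere. dist x z) |z. z \<in> unit_sphere}"
      using assms(3)
      by (simp add: gromov_compactification_def mtopology_sphere compactification_of_algebra_def)
    moreover have "(\<lambda>x\<in>unit_sphere. \<pi> (\<nu>' x) (- 2 *\<^sub>R z0)) \<in>
        {(\<lambda>x\<in>unit_sphere. h (\<nu>' x)) |h. continuous_map K' euclideanreal h}"
      by (intro CollectI exI[of _ "\<lambda>k. \<pi> k (- 2 *\<^sub>R z0)"] conjI refl \<pi>z)
    ultimately have "(\<lambda>x\<in>unit_sphere. \<pi> (\<nu>' x) (- 2 *\<^sub>R z0)) \<in>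
        generated_closed_unital_subalgebra (top_of_set unit_sphere) {(\<lambda>x\<in>unit_sphere. dist x z) |z. z \<in> unit_sphere}"
      by (simp only:)
    then have "controlled_by_distances unit_sphere (\<lambda>x\<in>unit_sphere. \<pi> (\<nu>' x) (- 2 *\<^sub>R z0))"
      by (rule gromov_algebra_controlled[rotated]) (auto simp: bounded_iff)
    moreover have "(\<lambda>x\<in>unit_sphere. \<pi> (\<nu>' x) (- 2 *\<^sub>R z0)) x = dist x (2 *\<^sub>R z0)" if "norm x = 1" for x
      using that by (simp add: \<pi>(2) distance_profile_def dist_norm)
    ultimately show False
      using distance_to_double_not_controlled[OF hom univ z0] by blast
  qed
qed

end
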